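(* Let $X, d$ be an algebraic Yoneda-complete quasi-metric space, with a strong basis $\mathcal B$. The space $\mathcal Q X, d_{\mathcal Q}$ is algebraic Yoneda-complete. Every non-empty compact saturated set of the form $\uparrow \{x_1, \cdots, x_n\}$ where every $x_i$ is a center point is a center point of $\mathcal Q X, d_{\mathcal Q}$, and those sets form a strong basis, even when each $x_i$ is taken from $\mathcal B$.
   Context: A quasi-metric on $X$ is a map $d \colon X \times X \to [0,+\infty]$ with $d(x,x)=0$, the triangle inequality, and $d(x,y)=d(y,x)=0 \Rightarrow x=y$. Formal balls are pairs $(x,r)$, $x\in X$, $r\in [0,+\infty)$, ordered by $(x,r) \leq^{d^+} (y,s)$ iff $d(x,y) \leq r-s$; they form the poset $\mathbf{B}(X,d)$, with its Scott topology. $X$ is given the $d$-Scott topology, the coarsest one making $x \mapsto (x,0) \in \mathbf{B}(X,d)$ continuous; $\uparrow$ is upward closure in the specialization ordering ($x \leq y$ iff $d(x,y)=0$). $X,d$ is Yoneda-complete iff $\mathbf{B}(X,d)$ is a dcpo. A point $x$ is a center point iff for every $\epsilon>0$, $\{(y,s) \in \mathbf{B}(X,d) \mid d(x,y) < \epsilon - s\}$ is Scott-open. A strong basis is a set $\mathcal{B}$ of center points such that for every $x \in X$, $(x,0)$ is the supremum in $\mathbf{B}(X,d)$ of a directed family of formal balls with centers in $\mathcal{B}$. $X,d$ is algebraic iff it has a strong basis. Compactness does not include any separation axiom; saturated means upwards-closed in the specialization ordering. $\mathcal{Q} X$ is the set of non-empty compact saturated subsets of $X$. $d_{\mathcal Q}(Q,Q')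 = \sup_{h} \mathsf{d}_{\mathbb R}(\min_{x\in Q} h(x), \min_{x\in Q'} h(x))$, where $h$ ranges over the $1$-Lipschitz continuous maps from $X,d$ to $[0,+\infty],\mathsf{d}_{\mathbb R}$ (those such that $(x,r)\mapsto(h(x),r)$ is Scott-continuous from $\mathbf{B}(X,d)$ to $\mathbf{B}([0,+\infty],\mathsf{d}_{\mathbb R})$), and $\mathsf{d}_{\mathbb R}(x,y)=0$ if $x \leq y$, $+\infty$ if $x=+\infty\neq y$, $x-y$ if $+\infty>x>y$; on Yoneda-complete spaces (more generally, standard ones), $d_{\mathcal Q}(Q,Q') = \sup_{x' \in Q'} \inf_{x\in Q} d(x,x')$. *)

theory Defs
  imports "HOL-Analysis.Analysis"
begin

subsection \<open>Directed completeness and the Scott topology on a carrier set\<close>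

definition directed_in :: "'p set \<Rightarrow> ('p \<Rightarrow> 'p \<Rightarrow> bool) \<Rightarrow> 'p set \<Rightarrow> bool" where
  "directed_in P le D \<longleftrightarrow>
     D \<subseteq> P \<and> D \<noteq> {} \<and> (\<forall>a\<in>D. \<forall>b\<in>D. \<exists>c\<in>D. le a c \<and> le b c)"

definition is_sup_in :: "'p set \<Rightarrow> ('p \<Rightarrow> 'p \<Rightarrow> bool) \<Rightarrow> 'p set \<Rightarrow> 'p \<Rightarrow> bool" where
  "is_sup_in P le D s \<longleftrightarrow>
     s \<in> P \<and> (\<forall>a\<in>D. le a s) \<and> (\<forall>u\<in>P. (\<forall>a\<in>D. le a u) \<longrightarrow> le s u)"

text \<open>The relation is only ever the formal-ball ordering of a quasi-metric space, which is a
  partial order (see the lemmas \<open>ball_le_refl\<close>, \<open>ball_le_trans\<close>, \<open>ball_le_antisym\<close>).\<close>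

definition dcpo_on :: "'p set \<Rightarrow> ('p \<Rightarrow> 'p \<Rightarrow> bool) \<Rightarrow> bool" where
  "dcpo_on P le \<longleftrightarrow> (\<forall>D. directed_in P le D \<longrightarrow> (\<exists>s. is_sup_in P le D s))"

definition scott_open :: "'p set \<Rightarrow> ('p \<Rightarrow> 'p \<Rightarrow> bool) \<Rightarrow> 'p set \<Rightarrow> bool" where
  "scott_open P le U \<longleftrightarrow>
     U \<subseteq> P \<and>
     (\<forall>a\<in>U. \<forall>b\<in>P. le a b \<longrightarrow> b \<in> U) \<and>
     (\<forall>D s. directed_in P le D \<and> is_sup_in P le D s \<and> s \<in> U \<longrightarrow> D \<inter> U \<noteq> {})"

definition scott_topology :: "'p set \<Rightarrow> ('p \<Rightarrow> 'p \<Rightarrow> bool) \<Rightarrow> 'p topology" where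
  "scott_topology P le = topology (scott_open P le)"

lemma istopology_scott_open: "istopology (scott_open P le)"
  unfolding istopology_def
proof (intro conjI allI impI)
  fix S T assume S: "scott_open P le S" and T: "scott_open P le T"
  show "scott_open P le (S \<inter> T)"
    unfolding scott_open_def
  proof (intro conjI allI impI)
    show "S \<inter> T \<subseteq> P" using S by (auto simp: scott_open_def)
    show "\<forall>a\<in>S \<inter> T. \<forall>b\<in>P. le a b \<longrightarrow> b \<in> S \<inter> T"
      using S T unfolding scott_open_def by blast
  next
    fix D s assume D: "directed_in P le D \<and> is_sup_in P le D s \<and> s \<in> S \<inter> T"
    obtain a where a: "a \<in> D" "a \<in> S" using S D unfolding scott_open_def by blast
    obtain b where b: "b \<in> D" "b \<in> T" using T D unfolding scott_open_def by blast
    obtain c where c: "c \<in> D" "le a c" "le b c"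
      using D a b unfolding directed_in_def by blast
    have "c \<in> P" using D c unfolding directed_in_def by blast
    then have "c \<in> S \<inter> T" using S T a b c unfolding scott_open_def by blast
    then show "D \<inter> (S \<inter> T) \<noteq> {}" using c by blast
  qed
next
  fix K assume K: "\<forall>S\<in>K. scott_open P le S"
  show "scott_open P le (\<Union>K)"
    unfolding scott_open_def
  proof (intro conjI allI impI)
    show "\<Union>K \<subseteq> P" using K unfolding scott_open_def by blast
    show "\<forall>a\<in>\<Union>K. \<forall>b\<in>P. le a b \<longrightarrow> b \<in> \<Union>K"
      using K unfolding scott_open_def by blast
  next
    fix D s assume D: "directed_in P le D \<and> is_sup_in P le D s \<and> s \<in> \<Union>K"
    then obtain S where S: "S \<in> K" "s \<in> S" by blast
    then have "D \<inter> S \<noteq> {}" using K D unfolding scott_open_def by blast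
    then show "D \<inter> \<Union>K \<noteq> {}" using S by blast
  qed
qed

lemma openin_scott_topology: "openin (scott_topology P le) U \<longleftrightarrow> scott_open P le U"
  by (simp add: scott_topology_def topology_inverse'[OF istopology_scott_open])

lemma topspace_scott_topology: "topspace (scott_topology P le) = P"
proof -
  have "scott_open P le P"
    by (auto simp: scott_open_def directed_in_def)
  then show ?thesis
    unfolding topspace_def openin_scott_topology by (auto simp: scott_open_def)
qed


subsection \<open>Quasi-metric spaces and formal balls\<close>

definition quasi_metric_on :: "'a set \<Rightarrow> ('a \<Rightarrow> 'a \<Rightarrow> ennreal) \<Rightarrow> bool" where
  "quasi_metric_on X d \<longleftrightarrow>
     (\<forall>x\<in>X. d x x = 0) \<and>
     (\<forall>x\<in>X. \<forall>y\<in>X. \<forall>z\<in>X. d x z \<le> d x y + d y z) \<and>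
     (\<forall>x\<in>X. \<forall>y\<in>X. d x y = 0 \<and> d y x = 0 \<longrightarrow> x = y)"

definition formal_balls :: "'a set \<Rightarrow> ('a \<times> real) set" where
  "formal_balls X = X \<times> {0..}"

text \<open>Since \<^term>\<open>ennreal\<close> sends negative reals to \<open>0\<close>, the condition \<open>s \<le> r\<close>, implicit in
  \<open>d x y \<le> r - s\<close>, has to be made explicit.\<close>

definition ball_le :: "('a \<Rightarrow> 'a \<Rightarrow> ennreal) \<Rightarrow> 'a \<times> real \<Rightarrow> 'a \<times> real \<Rightarrow> bool" where
  "ball_le d = (\<lambda>(x, r) (y, s). s \<le> r \<and> d x y \<le> ennreal (r - s))"

abbreviation ball_scott :: "'a set \<Rightarrow> ('a \<Rightarrow> 'a \<Rightarrow> ennreal) \<Rightarrow> ('a \<times> real) topology" where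
  "ball_scott X d \<equiv> scott_topology (formal_balls X) (ball_le d)"

lemma ball_le_refl:
  assumes "quasi_metric_on X d" "a \<in> formal_balls X"
  shows "ball_le d a a"
  using assms by (auto simp: quasi_metric_on_def formal_balls_def ball_le_def)

lemma ball_le_trans:
  assumes "quasi_metric_on X d"
    and "a \<in> formal_balls X" "b \<in> formal_balls X" "c \<in> formal_balls X"
    and "ball_le d a b" "ball_le d b c"
  shows "ball_le d a c"
proof -
  obtain x r y s z t where abc: "a = (x, r)" "b = (y, s)" "c = (z, t)"
    by (metis surj_pair)
  have le: "s \<le> r" "t \<le> s" "d x y \<le> ennreal (r - s)" "d y z \<le> ennreal (s - t)"
    using assms by (auto simp: abc ball_le_def)
  have "d x z \<le> d x y + d y z"
    using assms by (auto simp: abc quasi_metric_on_def formal_balls_def)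
  also have "\<dots> \<le> ennreal (r - s) + ennreal (s - t)"
    using le by (intro add_mono)
  also have "\<dots> = ennreal (r - t)"
    using le by (simp flip: ennreal_plus)
  finally show ?thesis using le by (simp add: abc ball_le_def)
qed

lemma ball_le_antisym:
  assumes "quasi_metric_on X d"
    and "a \<in> formal_balls X" "b \<in> formal_balls X" "ball_le d a b" "ball_le d b a"
  shows "a = b"
  using assms by (auto simp: quasi_metric_on_def formal_balls_def ball_le_def)

text \<open>The coarsest topology on \<^term>\<open>X\<close> making \<open>x \<mapsto> (x, 0)\<close> continuous.\<close>

definition d_scott :: "'a set \<Rightarrow> ('a \<Rightarrow> 'a \<Rightarrow> ennreal) \<Rightarrow> 'a topology" where
  "d_scott X d = pullback_topology X (\<lambda>x. (x, 0)) (ball_scott X d)"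

lemma topspace_d_scott: "topspace (d_scott X d) = X"
  by (auto simp: d_scott_def topspace_pullback_topology topspace_scott_topology formal_balls_def)

definition upward_closure :: "'a set \<Rightarrow> ('a \<Rightarrow> 'a \<Rightarrow> ennreal) \<Rightarrow> 'a set \<Rightarrow> 'a set" where
  "upward_closure X d A = {y \<in> X. \<exists>x\<in>A. d x y = 0}"

text \<open>The relation \<open>d x y = 0\<close> is indeed the specialization ordering of the \<open>d\<close>-Scott topology.\<close>

lemma specialization_d_scott:
  assumes qm: "quasi_metric_on X d" and x: "x \<in> X" and y: "y \<in> X"
  shows "d x y = 0 \<longleftrightarrow> (\<forall>U. openin (d_scott X d) U \<and> x \<in> U \<longrightarrow> y \<in> U)"
proof (intro iffI allI impI)
  fix U assume xy: "d x y = 0" and U: "openin (d_scott X d) U \<and> x \<in> U"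
  then obtain V where V: "scott_open (formal_balls X) (ball_le d) V" "U = (\<lambda>x. (x, 0)) -` V \<inter> X"
    by (auto simp: d_scott_def openin_pullback_topology openin_scott_topology)
  have "(x, 0) \<in> V" using U V by auto
  moreover have "ball_le d (x, 0) (y, 0)" using xy by (simp add: ball_le_def)
  moreover have "(y, 0) \<in> formal_balls X" using y by (simp add: formal_balls_def)
  ultimately have "(y, 0) \<in> V" using V(1) unfolding scott_open_def by blast
  then show "y \<in> U" using V y by auto
next
  assume R: "\<forall>U. openin (d_scott X d) U \<and> x \<in> U \<longrightarrow> y \<in> U"
  define V where "V = {b \<in> formal_balls X. \<not> ball_le d b (y, 0)}"
  have y0: "(y, 0) \<in> formal_balls X" using y by (simp add: formal_balls_def)
  have "scott_open (formal_balls X) (ball_le d) V"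
    unfolding scott_open_def
  proof (intro conjI ballI allI impI)
    show "V \<subseteq> formal_balls X" by (auto simp: V_def)
    show "b \<in> V" if "a \<in> V" "b \<in> formal_balls X" "ball_le d a b" for a b
      using that ball_le_trans[OF qm _ that(2) y0, of a] unfolding V_def by blast
  next
    fix D s
    assume D: "directed_in (formal_balls X) (ball_le d) D \<and>
      is_sup_in (formal_balls X) (ball_le d) D s \<and> s \<in> V"
    then have "\<not> (\<forall>a\<in>D. ball_le d a (y, 0))"
      using y0 unfolding is_sup_in_def V_def by blast
    then show "D \<inter> V \<noteq> {}" using D unfolding directed_in_def V_def by blast
  qed
  then have "openin (d_scott X d) ((\<lambda>x. (x, 0)) -` V \<inter> X)"
    unfolding d_scott_def openin_pullback_topology openin_scott_topology by blast
  moreover have "(y, 0) \<notin> V" using ball_le_refl[OF qm y0] by (simp add: V_def)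
  ultimately have "(x, 0) \<notin> V" using R x by blast
  then show "d x y = 0" using x by (auto simp: V_def formal_balls_def ball_le_def)
qed

definition yoneda_complete :: "'a set \<Rightarrow> ('a \<Rightarrow> 'a \<Rightarrow> ennreal) \<Rightarrow> bool" where
  "yoneda_complete X d \<longleftrightarrow> dcpo_on (formal_balls X) (ball_le d)"

text \<open>Here truncation at \<open>0\<close> is harmless: if \<open>\<epsilon> \<le> s\<close> then \<open>d x y < ennreal (\<epsilon> - s)\<close> is false.\<close>

definition center_points :: "'a set \<Rightarrow> ('a \<Rightarrow> 'a \<Rightarrow> ennreal) \<Rightarrow> 'a set" where
  "center_points X d =
     {x \<in> X. \<forall>\<epsilon>>0. openin (ball_scott X d)
                 {(y, s). (y, s) \<in> formal_balls X \<and> d x y < ennreal (\<epsilon> - s)}}"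

definition strong_basis :: "'a set \<Rightarrow> ('a \<Rightarrow> 'a \<Rightarrow> ennreal) \<Rightarrow> 'a set \<Rightarrow> bool" where
  "strong_basis X d B \<longleftrightarrow>
     B \<subseteq> center_points X d \<and>
     (\<forall>x\<in>X. \<exists>D. directed_in (formal_balls X) (ball_le d) D \<and> fst ` D \<subseteq> B \<and>
                 is_sup_in (formal_balls X) (ball_le d) D (x, 0))"

definition algebraic_qm :: "'a set \<Rightarrow> ('a \<Rightarrow> 'a \<Rightarrow> ennreal) \<Rightarrow> bool" where
  "algebraic_qm X d \<longleftrightarrow> (\<exists>B. strong_basis X d B)"


subsection \<open>The Smyth powerdomain\<close>

definition d_real :: "ennreal \<Rightarrow> ennreal \<Rightarrow> ennreal" where
  "d_real x y = (if x \<le> y then 0 else if x = \<infinity> then \<infinity> else x - y)"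

text \<open>Being \<open>1\<close>-Lipschitz is the monotonicity of \<open>(x, r) \<mapsto> (h x, r)\<close>, which is part of its
  Scott continuity.\<close>

definition lipschitz1_continuous ::
    "'a set \<Rightarrow> ('a \<Rightarrow> 'a \<Rightarrow> ennreal) \<Rightarrow> ('a \<Rightarrow> ennreal) \<Rightarrow> bool" where
  "lipschitz1_continuous X d h \<longleftrightarrow>
     continuous_map (ball_scott X d) (ball_scott UNIV d_real) (\<lambda>(x, r). (h x, r))"

definition Smyth :: "'a set \<Rightarrow> ('a \<Rightarrow> 'a \<Rightarrow> ennreal) \<Rightarrow> 'a set set" where
  "Smyth X d = {Q. Q \<noteq> {} \<and> compactin (d_scott X d) Q \<and> upward_closure X d Q = Q}"

text \<open>On a non-empty compact set a lower semicontinuous map attains its infimum, so the two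
  infima below are minima whenever \<open>Q\<close> and \<open>Q'\<close> belong to \<^term>\<open>Smyth X d\<close>.\<close>

definition d_Smyth :: "'a set \<Rightarrow> ('a \<Rightarrow> 'a \<Rightarrow> ennreal) \<Rightarrow> 'a set \<Rightarrow> 'a set \<Rightarrow> ennreal" where
  "d_Smyth X d Q Q' =
     (SUP h\<in>{h. lipschitz1_continuous X d h}. d_real (INF x\<in>Q. h x) (INF x\<in>Q'. h x))"

end

theory Submission
  imports Defs
begin

text \<open>Write \<open>d_Q(Q, Q') \<le> t\<close> as: every point of \<open>Q'\<close> is within \<open>t\<close> of some point of \<open>Q\<close>. Then
  a directed family of formal balls \<open>(Q\<^sub>i, r\<^sub>i)\<close> over the Smyth powerdomain is a filtered family of
  compact sets \<open>Q\<^sub>i \<times> {r\<^sub>i}\<close> in the space of formal balls of \<open>X\<close>. Since \<open>X\<close> is algebraic, that space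
  is a continuous dcpo, hence well-filtered: once the radii are shifted so that \<open>inf r\<^sub>i = 0\<close>, an
  open set containing the part \<open>Q \<times> {0}\<close> of the intersection of the upward closures already contains
  some \<open>Q\<^sub>i \<times> {r\<^sub>i}\<close>. So \<open>Q\<close> is non-empty and compact and \<open>(Q, 0)\<close> is the supremum; the same
  property applied to a finite union of open balls makes \<open>\<up>{x\<^sub>1, \<dots>, x\<^sub>n}\<close> a center point.
  Conversely, covering \<open>Q \<times> {0}\<close> by finitely many small balls with centers in the basis
  approximates \<open>(Q, 0)\<close> by balls around finitely generated sets.\<close>

subsection \<open>Orders of formal balls\<close>

lemma is_sup_in_unique:
  assumes "quasi_metric_on X d"
    and "is_sup_in (formal_balls X) (ball_le d) D a" "is_sup_in (formal_balls X) (ball_le d) D b"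
  shows "a = b"
  using ball_le_antisym[OF assms(1)] assms(2,3) unfolding is_sup_in_def by blast

lemma scott_open_not_below:
  assumes qm: "quasi_metric_on X d" and z: "z \<in> formal_balls X"
  shows "scott_open (formal_balls X) (ball_le d) {b \<in> formal_balls X. \<not> ball_le d b z}"
  unfolding scott_open_def
proof (intro conjI ballI allI impI)
  fix a b
  assume "a \<in> {b \<in> formal_balls X. \<not> ball_le d b z}" "b \<in> formal_balls X" "ball_le d a b"
  then show "b \<in> {b \<in> formal_balls X. \<not> ball_le d b z}"
    using ball_le_trans[OF qm _ _ z, of a b] by blast
next
  fix D s
  assume "directed_in (formal_balls X) (ball_le d) D \<and> is_sup_in (formal_balls X) (ball_le d) D s
    \<and> s \<in> {b \<in> formal_balls X. \<not> ball_le d b z}"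
  then show "D \<inter> {b \<in> formal_balls X. \<not> ball_le d b z} \<noteq> {}"
    using z unfolding directed_in_def is_sup_in_def by blast
qed auto

text \<open>Continuity alone gives monotonicity: the balls not below \<open>f b\<close> form a
  Scott-open set, whose preimage is upward closed and so would contain \<open>b\<close> as soon as
  it contained \<open>a\<close>. This is what yields the Lipschitz inequality.\<close>

lemma scott_continuous_mono:
  assumes qm: "quasi_metric_on Y e"
    and cont: "continuous_map (ball_scott X d) (ball_scott Y e) f"
    and ab: "a \<in> formal_balls X" "b \<in> formal_balls X" "ball_le d a b"
  shows "ball_le e (f a) (f b)"
proof (rule ccontr)
  assume nle: "\<not> ball_le e (f a) (f b)"
  have f: "f c \<in> formal_balls Y" if "c \<in> formal_balls X" for c
    using continuous_map_funspace[OF cont] that by (auto simp: topspace_scott_topology)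
  let ?V = "{c \<in> formal_balls Y. \<not> ball_le e c (f b)}"
  have "scott_open (formal_balls X) (ball_le d) {c \<in> formal_balls X. f c \<in> ?V}"
    using openin_continuous_map_preimage[OF cont, of ?V] scott_open_not_below[OF qm f[OF ab(2)]]
    by (simp add: openin_scott_topology topspace_scott_topology)
  then have "f b \<in> ?V"
    using ab nle f[OF ab(1)] unfolding scott_open_def by blast
  then show False using ball_le_refl[OF qm] by blast
qed

section \<open>Translation of radii\<close>

text \<open>The constant may be negative, so results on \<open>shift\<close> carry a side condition
  keeping the translated radii nonnegative.\<close>

definition shift :: "real \<Rightarrow> ('a \<times> real) set \<Rightarrow> ('a \<times> real) set" where
  "shift c D = (\<lambda>(x, r). (x, r + c)) ` D"

lemma mem_shift_iff: "(x, r) \<in> shift c D \<longleftrightarrow> (x, r - c) \<in> D"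
  by (force simp: shift_def)

lemma ball_le_shift: "ball_le d (x, r + c) (y, s + c) \<longleftrightarrow> ball_le d (x, r) (y, s)"
  by (simp add: ball_le_def)

lemma directed_in_shift:
  assumes D: "directed_in (formal_balls X) (ball_le d) D" and c: "\<And>x r. (x, r) \<in> D \<Longrightarrow> 0 \<le> r + c"
  shows "directed_in (formal_balls X) (ball_le d) (shift c D)"
  unfolding directed_in_def
proof (intro conjI ballI)
  show "shift c D \<subseteq> formal_balls X"
    using D c by (auto simp: directed_in_def shift_def formal_balls_def)
  show "shift c D \<noteq> {}" using D by (simp add: directed_in_def shift_def)
  fix a b assume "a \<in> shift c D" "b \<in> shift c D"
  then obtain x r y s where ab: "(x, r) \<in> D" "(y, s) \<in> D" "a = (x, r + c)" "b = (y, s + c)"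
    by (auto simp: shift_def)
  then obtain z t where "(z, t) \<in> D" "ball_le d (x, r) (z, t)" "ball_le d (y, s) (z, t)"
    using D unfolding directed_in_def by (metis surj_pair)
  then show "\<exists>z\<in>shift c D. ball_le d a z \<and> ball_le d b z"
    by (intro bexI[of _ "(z, t + c)"]) (auto simp: ab ball_le_shift mem_shift_iff)
qed

lemma directed_radius_Inf:
  assumes "directed_in (formal_balls X) le D"
  obtains m where "0 \<le> m" "\<And>x r. (x, r) \<in> D \<Longrightarrow> m \<le> r" "\<And>e. e > 0 \<Longrightarrow> \<exists>(x, r)\<in>D. r < m + e"
proof
  have ne: "snd ` D \<noteq> {}" and nn: "\<And>r. r \<in> snd ` D \<Longrightarrow> 0 \<le> r"
    using assms by (auto simp: directed_in_def formal_balls_def)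
  have bdd: "bdd_below (snd ` D)" using nn by (meson bdd_belowI)
  show "0 \<le> Inf (snd ` D)" using cInf_greatest[OF ne] nn by blast
  show "Inf (snd ` D) \<le> r" if "(x, r) \<in> D" for x r
    using cInf_lower[OF _ bdd] that by force
  show "\<exists>(x, r)\<in>D. r < Inf (snd ` D) + e" if "e > 0" for e
    using cInf_lessD[OF ne, of "Inf (snd ` D) + e"] that by force
qed

section \<open>The quasi-metric on extended nonnegative reals\<close>

text \<open>Residuation: truncated subtraction, infinite cases included, becomes an additive
  inequality, and bounds on \<open>d_real\<close> follow from monotonicity of addition.\<close>

lemma d_real_le_iff: "d_real a b \<le> c \<longleftrightarrow> a \<le> b + c"
proof (cases "a \<le> b")
  case True
  then show ?thesis by (auto simp: d_real_def intro: order_trans[OF _ le_iff_add[THEN iffD2]])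
next
  case False
  then show ?thesis
    by (auto simp: d_real_def ennreal_minus_le_iff top_unique add.commute)
qed

lemma quasi_metric_on_d_real: "quasi_metric_on UNIV d_real"
  unfolding quasi_metric_on_def
proof (intro conjI ballI impI)
  show "d_real x x = 0" for x by (simp add: d_real_def)
  have le: "a \<le> b + d_real a b" for a b using d_real_le_iff by blast
  show "d_real x z \<le> d_real x y + d_real y z" for x y z
    unfolding d_real_le_iff
    using order_trans[OF le[of x y] add_right_mono[OF le[of y z]]]
    by (simp add: ac_simps)
  show "x = y" if "d_real x y = 0 \<and> d_real y x = 0" for x y
    using le[of x y] le[of y x] that by simp
qed

lemma INF_add_const_ennreal:
  fixes f :: "'i \<Rightarrow> ennreal"
  assumes "I \<noteq> {}"
  shows "(INF i\<in>I. f i + c) = (INF i\<in>I. f i) + c"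
  using continuous_at_Inf_mono[of "\<lambda>x. x + c" "f ` I"] assms
    continuous_add[of "at_right (Inf (f ` I))", of "\<lambda>x. x" "\<lambda>x. c"]
  by (auto simp: mono_def image_comp)

subsection \<open>Yoneda-complete spaces are standard\<close>

locale yoneda_qm =
  fixes X :: "'a set" and d :: "'a \<Rightarrow> 'a \<Rightarrow> ennreal"
  assumes qm: "quasi_metric_on X d" and yoneda: "yoneda_complete X d"
begin

abbreviation "FB \<equiv> formal_balls X"

lemma mem_FB: "(x, r) \<in> FB \<longleftrightarrow> x \<in> X \<and> 0 \<le> r"
  by (auto simp: formal_balls_def)

lemma qm_triangle: "x \<in> X \<Longrightarrow> y \<in> X \<Longrightarrow> z \<in> X \<Longrightarrow> d x z \<le> d x y + d y z"
  using qm by (auto simp: quasi_metric_on_def)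

lemma qm_refl: "x \<in> X \<Longrightarrow> d x x = 0"
  using qm by (auto simp: quasi_metric_on_def)

text \<open>Here \<open>m\<close> is the infimum of the radii, and the point is that
  \<open>y\<close> does not depend on \<open>c\<close>. A supremum of \<open>shift (- m) D\<close>
  must have radius 0; call its center \<open>y\<close>. For larger \<open>c\<close>,
  \<open>(y, c)\<close> bounds the translate, so the supremum \<open>(z, s)\<close> has
  \<open>s = c\<close>; translating back makes \<open>(z, 0)\<close> an upper bound of the first
  family, and antisymmetry gives \<open>y = z\<close>.\<close>

lemma sup_of_shifts:
  assumes D: "directed_in FB (ball_le d) D"
    and m: "\<And>x r. (x, r) \<in> D \<Longrightarrow> m \<le> r" "\<And>e. e > 0 \<Longrightarrow> \<exists>(x, r)\<in>D. r < m + e"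
  shows "\<exists>y\<in>X. \<forall>c\<ge>0. is_sup_in FB (ball_le d) (shift (c - m) D) (y, c)"
proof -
  have dir: "directed_in FB (ball_le d) (shift (c - m) D)" if "c \<ge> 0" for c
    using that m(1) by (intro directed_in_shift[OF D]) force
  have le: "t \<le> c" if "is_sup_in FB (ball_le d) (shift (c - m) D) (y, t)" for c y t
  proof (rule field_le_epsilon)
    fix e :: real assume "e > 0"
    then obtain x r where xr: "(x, r) \<in> D" "r < m + e" using m(2) by blast
    then have "ball_le d (x, r + (c - m)) (y, t)"
      using that by (auto simp: is_sup_in_def mem_shift_iff)
    then show "t \<le> c + e" using xr by (auto simp: ball_le_def)
  qed
  obtain y t where "is_sup_in FB (ball_le d) (shift (0 - m) D) (y, t)"
    using yoneda dir[of 0] unfolding yoneda_complete_def dcpo_on_def by (metis order_refl surj_pair)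
  moreover from this have "t = 0"
    using le[of 0 y t] by (auto simp: is_sup_in_def mem_FB)
  ultimately have y: "is_sup_in FB (ball_le d) (shift (- m) D) (y, 0)" by simp
  then have yX: "y \<in> X" by (auto simp: is_sup_in_def mem_FB)
  show ?thesis
  proof (intro bexI[OF _ yX] allI impI)
    fix c :: real assume c: "c \<ge> 0"
    obtain z s where z: "is_sup_in FB (ball_le d) (shift (c - m) D) (z, s)"
      using yoneda dir[of c] c unfolding yoneda_complete_def dcpo_on_def by (metis surj_pair)
    have "ball_le d (x, r) (y, c)" if "(x, r) \<in> shift (c - m) D" for x r
    proof -
      have "(x, r - c) \<in> shift (- m) D" using that by (simp add: mem_shift_iff algebra_simps)
      then have "ball_le d (x, r - c) (y, 0)" using y by (auto simp: is_sup_in_def)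
      then show ?thesis using ball_le_shift[of d x "r - c" c y 0] by simp
    qed
    then have zy: "ball_le d (z, s) (y, c)"
      using z yX c unfolding is_sup_in_def by (metis mem_FB surj_pair)
    then have s: "s = c" using le[OF z] by (simp add: ball_le_def)
    have "ball_le d (x, r) (z, 0)" if "(x, r) \<in> shift (- m) D" for x r
    proof -
      have "(x, r + c) \<in> shift (c - m) D" using that by (simp add: mem_shift_iff algebra_simps)
      then have "ball_le d (x, r + c) (z, c)" using z s by (auto simp: is_sup_in_def)
      then show ?thesis using ball_le_shift[of d x r c z 0] by simp
    qed
    then have "ball_le d (y, 0) (z, 0)"
      using y z unfolding is_sup_in_def by (metis mem_FB order_refl surj_pair)
    then have "y = z"
      using zy s qm yX z by (auto simp: ball_le_def quasi_metric_on_def is_sup_in_def mem_FB)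
    then show "is_sup_in FB (ball_le d) (shift (c - m) D) (y, c)" using z s by simp
  qed
qed

text \<open>The case \<open>c = m\<close> of \<open>sup_of_shifts\<close> concerns \<open>D\<close>
  itself, so uniqueness identifies the given supremum with \<open>(y, m)\<close>: its radius is the
  infimum of the radii, and suprema commute with translation, also downwards.\<close>

lemma sup_standard:
  assumes D: "directed_in FB (ball_le d) D" and s: "is_sup_in FB (ball_le d) D (x, r)"
  shows "\<And>c. 0 \<le> r + c \<Longrightarrow> is_sup_in FB (ball_le d) (shift c D) (x, r + c)"
    and "\<And>e. e > 0 \<Longrightarrow> \<exists>(y, t)\<in>D. t < r + e"
proof -
  obtain m where m: "0 \<le> m" "\<And>x r. (x, r) \<in> D \<Longrightarrow> m \<le> r" "\<And>e. e > 0 \<Longrightarrow> \<exists>(x, r)\<in>D. r < m + e"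
    using directed_radius_Inf[OF D] by metis
  obtain y where y: "\<And>c. c \<ge> 0 \<Longrightarrow> is_sup_in FB (ball_le d) (shift (c - m) D) (y, c)"
    using sup_of_shifts[OF D, of m] m(2,3) by blast
  have "is_sup_in FB (ball_le d) D (y, m)" using y[OF m(1)] by (simp add: shift_def)
  then have eq: "x = y" "r = m" using is_sup_in_unique[OF qm s] by auto
  show "is_sup_in FB (ball_le d) (shift c D) (x, r + c)" if "0 \<le> r + c" for c
    using y[OF that] eq by simp
  show "\<exists>(y, t)\<in>D. t < r + e" if "e > 0" for e using m(3)[OF that] eq by simp
qed

section \<open>Open and compact sets of formal balls\<close>

text \<open>Translation by \<open>c\<close> preserves directed suprema by
  \<open>sup_standard\<close>, so it is Scott-continuous and this preimage is open.\<close>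

lemma scott_open_shift:
  assumes V: "scott_open FB (ball_le d) V" and c: "c \<ge> 0"
  shows "scott_open FB (ball_le d) {(y, t). (y, t) \<in> FB \<and> (y, t + c) \<in> V}"
  unfolding scott_open_def
proof (intro conjI allI ballI impI)
  fix a b assume a: "a \<in> {(y, t). (y, t) \<in> FB \<and> (y, t + c) \<in> V}" and b: "b \<in> FB" "ball_le d a b"
  obtain y t z s where ab: "a = (y, t)" "b = (z, s)" by fastforce
  have "ball_le d (y, t + c) (z, s + c)" using b by (simp add: ab ball_le_shift)
  moreover have "(z, s + c) \<in> FB" using b c by (simp add: ab mem_FB)
  ultimately show "b \<in> {(y, t). (y, t) \<in> FB \<and> (y, t + c) \<in> V}"
    using V a b unfolding scott_open_def ab by blast
next
  fix D s assume "directed_in FB (ball_le d) D \<and> is_sup_in FB (ball_le d) D s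
    \<and> s \<in> {(y, t). (y, t) \<in> FB \<and> (y, t + c) \<in> V}"
  moreover obtain y t where s: "s = (y, t)" by fastforce
  ultimately have D: "directed_in FB (ball_le d) D" "is_sup_in FB (ball_le d) D (y, t)"
    and yt: "(y, t + c) \<in> V" "(y, t) \<in> FB" by auto
  have "directed_in FB (ball_le d) (shift c D)"
    using D(1) c by (intro directed_in_shift) (auto simp: directed_in_def formal_balls_def)
  moreover have "is_sup_in FB (ball_le d) (shift c D) (y, t + c)"
    using sup_standard(1)[OF D] yt(2) c by (simp add: mem_FB)
  ultimately obtain z u where "(z, u) \<in> shift c D" "(z, u) \<in> V"
    using V yt(1) unfolding scott_open_def by (metis Int_emptyI surj_pair)
  then have "(z, u - c) \<in> D" "(z, u - c + c) \<in> V" by (auto simp: mem_shift_iff)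
  moreover have "(z, u - c) \<in> FB" using \<open>(z, u - c) \<in> D\<close> D(1) by (auto simp: directed_in_def)
  ultimately show "D \<inter> {(y, t). (y, t) \<in> FB \<and> (y, t + c) \<in> V} \<noteq> {}" by blast
qed auto

text \<open>This is the basic open set separating balls from a point \<open>z\<close>:
  \<open>(y, t)\<close> belongs to it when \<open>y\<close> stays further than \<open>t + c\<close>
  from \<open>z\<close>.\<close>

lemma scott_open_far:
  assumes "z \<in> X" "c \<ge> 0"
  shows "scott_open FB (ball_le d) {(y, t). (y, t) \<in> FB \<and> \<not> ball_le d (y, t + c) (z, 0)}"
proof -
  have "(z, 0) \<in> FB" using assms by (simp add: mem_FB)
  from scott_open_shift[OF scott_open_not_below[OF qm this] assms(2)]
  show ?thesis using assms(2) by (simp add: mem_FB cong: conj_cong)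
qed

text \<open>The definition of the \<open>d\<close>-Scott topology makes
  \<open>x \<mapsto> (x, c)\<close> continuous for \<open>c = 0\<close> only; translation of open
  sets extends this to every \<open>c\<close>.\<close>

lemma compactin_ball:
  assumes "compactin (d_scott X d) Q" and c: "c \<ge> 0"
  shows "compactin (ball_scott X d) (Q \<times> {c})"
proof -
  have "continuous_map (d_scott X d) (ball_scott X d) (\<lambda>x. (x, c))"
    unfolding continuous_map_def topspace_d_scott topspace_scott_topology openin_scott_topology
  proof (intro conjI allI impI)
    show "(\<lambda>x. (x, c)) \<in> X \<rightarrow> FB" using c by (auto simp: mem_FB)
    fix U assume U: "scott_open FB (ball_le d) U"
    show "openin (d_scott X d) {x \<in> X. (x, c) \<in> U}"
      unfolding d_scott_def openin_pullback_topology openin_scott_topology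
      using scott_open_shift[OF U c] by (intro exI conjI) (auto simp: mem_FB)
  qed
  moreover have "Q \<times> {c} = (\<lambda>x. (x, c)) ` Q" by auto
  ultimately show ?thesis using image_compactin[OF assms(1)] by simp
qed

text \<open>Every open set of \<open>X\<close> is the trace at radius 0 of a Scott-open set of
  balls, so covers lift and finite subcovers descend.\<close>

lemma compactin_ball_0:
  assumes Q: "compactin (ball_scott X d) (Q \<times> {0})"
  shows "compactin (d_scott X d) Q"
  unfolding compactin_def topspace_d_scott
proof (intro conjI allI impI)
  show QX: "Q \<subseteq> X"
    using compactin_subset_topspace[OF Q] by (auto simp: topspace_scott_topology mem_FB)
  fix \<U> assume \<U>: "Ball \<U> (openin (d_scott X d)) \<and> Q \<subseteq> \<Union>\<U>"
  then have "\<forall>U\<in>\<U>. \<exists>V. scott_open FB (ball_le d) V \<and> U = (\<lambda>x. (x, 0)) -` V \<inter> X"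
    unfolding d_scott_def openin_pullback_topology openin_scott_topology by blast
  then obtain V where V: "\<And>U. U \<in> \<U> \<Longrightarrow> scott_open FB (ball_le d) (V U)"
      "\<And>U. U \<in> \<U> \<Longrightarrow> U = (\<lambda>x. (x, 0)) -` V U \<inter> X"
    by metis
  have "Q \<times> {0} \<subseteq> \<Union>(V ` \<U>)" using \<U> V(2) by fastforce
  moreover have "Ball (V ` \<U>) (openin (ball_scott X d))" using V(1) by (simp add: openin_scott_topology)
  ultimately obtain \<F> where "finite \<F>" "\<F> \<subseteq> V ` \<U>" "Q \<times> {0} \<subseteq> \<Union>\<F>"
    using Q unfolding compactin_def by meson
  then obtain \<G> where \<G>: "finite \<G>" "\<G> \<subseteq> \<U>" "Q \<times> {0} \<subseteq> \<Union>(V ` \<G>)"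
    by (metis finite_subset_image)
  have "Q \<subseteq> \<Union>\<G>"
  proof
    fix x assume x: "x \<in> Q"
    then obtain U where "U \<in> \<G>" "(x, 0) \<in> V U" using \<G>(3) by blast
    then show "x \<in> \<Union>\<G>" using V(2)[of U] \<G>(2) x QX by blast
  qed
  then show "\<exists>\<F>. finite \<F> \<and> \<F> \<subseteq> \<U> \<and> Q \<subseteq> \<Union>\<F>" using \<G> by blast
qed

subsection \<open>The Smyth quasi-metric\<close>

lemma lipschitz1_continuous_le:
  assumes h: "lipschitz1_continuous X d h" and xy: "x \<in> X" "y \<in> X"
  shows "h x \<le> h y + d x y"
proof (cases "d x y")
  case (real t)
  then have "ball_le d_real (h x, t) (h y, 0)"
    using scott_continuous_mono[OF quasi_metric_on_d_real h[unfolded lipschitz1_continuous_def],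
        of "(x, t)" "(y, 0)"] xy
    by (simp add: mem_FB ball_le_def)
  then show ?thesis using real by (simp add: ball_le_def d_real_le_iff)
qed simp

text \<open>These are the test maps that realize \<open>d_Smyth\<close>. Monotonicity is the
  triangle inequality; preservation of suprema rests on standardness.\<close>

lemma lipschitz1_continuous_dist:
  assumes z: "z \<in> X"
  shows "lipschitz1_continuous X d (\<lambda>x. d x z)"
  unfolding lipschitz1_continuous_def continuous_map_def topspace_scott_topology
    openin_scott_topology
proof (intro conjI allI impI)
  let ?h = "\<lambda>(x, r :: real). (d x z, r)"
  have mono: "ball_le d_real (?h a) (?h b)" if ab: "a \<in> FB" "b \<in> FB" "ball_le d a b" for a b
  proof -
    obtain x r y s where e: "a = (x, r)" "b = (y, s)" by fastforce
    have "d x z \<le> d x y + d y z" using ab z qm_triangle by (auto simp: e mem_FB)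
    also have "\<dots> \<le> ennreal (r - s) + d y z"
      using ab by (intro add_right_mono) (auto simp: e ball_le_def)
    finally show ?thesis using ab by (simp add: e ball_le_def d_real_le_iff add.commute)
  qed
  show "?h \<in> FB \<rightarrow> formal_balls UNIV" by (auto simp: formal_balls_def)
  fix U assume U: "scott_open (formal_balls UNIV) (ball_le d_real) U"
  show "scott_open FB (ball_le d) {a \<in> FB. ?h a \<in> U}"
    unfolding scott_open_def
  proof (intro conjI ballI allI impI)
    fix a b assume "a \<in> {a \<in> FB. ?h a \<in> U}" "b \<in> FB" "ball_le d a b"
    then show "b \<in> {a \<in> FB. ?h a \<in> U}"
      using U mono[of a b] unfolding scott_open_def by (auto simp: formal_balls_def)
  next
    fix D s assume Ds: "directed_in FB (ball_le d) D \<and> is_sup_in FB (ball_le d) D s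
      \<and> s \<in> {a \<in> FB. ?h a \<in> U}"
    obtain x r where s: "s = (x, r)" by fastforce
    have D: "directed_in FB (ball_le d) D" and sup: "is_sup_in FB (ball_le d) D (x, r)"
      and hs: "(d x z, r) \<in> U" and xr: "x \<in> X" "0 \<le> r" using Ds by (auto simp: s mem_FB)
    have DFB: "D \<subseteq> FB" using D by (simp add: directed_in_def)
    have dir: "directed_in (formal_balls UNIV) (ball_le d_real) (?h ` D)"
      unfolding directed_in_def
    proof (intro conjI ballI)
      show "?h ` D \<subseteq> formal_balls UNIV" using DFB by (auto simp: formal_balls_def)
      show "?h ` D \<noteq> {}" using D by (simp add: directed_in_def)
      fix u v assume "u \<in> ?h ` D" "v \<in> ?h ` D"
      then obtain a b where ab: "a \<in> D" "b \<in> D" "u = ?h a" "v = ?h b" by blast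
      then obtain c where c: "c \<in> D" "ball_le d a c" "ball_le d b c"
        using D unfolding directed_in_def by blast
      then show "\<exists>w\<in>?h ` D. ball_le d_real u w \<and> ball_le d_real v w"
        using ab mono DFB by blast
    qed
    have "is_sup_in (formal_balls UNIV) (ball_le d_real) (?h ` D) (d x z, r)"
      unfolding is_sup_in_def
    proof (intro conjI ballI impI)
      show "(d x z, r) \<in> formal_balls UNIV" using xr by (simp add: formal_balls_def)
      fix u assume "u \<in> ?h ` D"
      then obtain a where a: "a \<in> D" "u = ?h a" by blast
      then have "ball_le d a (x, r)" using sup by (auto simp: is_sup_in_def)
      then show "ball_le d_real u (d x z, r)"
        using mono[of a "(x, r)"] a DFB xr by (auto simp: mem_FB)
    next
      fix u assume u: "u \<in> formal_balls UNIV" "\<forall>a\<in>?h ` D. ball_le d_real a u"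
      obtain b t where bt: "u = (b, t)" by fastforce
      have ub: "t \<le> q" "d y z \<le> b + ennreal (q - t)" if "(y, q) \<in> D" for y q
        using u(2) that by (force simp: bt ball_le_def d_real_le_iff)+
      have tr: "t \<le> r"
      proof (rule field_le_epsilon)
        fix e :: real assume "e > 0"
        then show "t \<le> r + e" using sup_standard(2)[OF D sup] ub(1) by fastforce
      qed
      have t0: "0 \<le> t" using u(1) by (simp add: bt formal_balls_def)
      have "d x z \<le> b + ennreal (r - t)"
      proof (cases b)
        case (real c)
        \<comment> \<open>For finite \<open>b = c\<close>, the bound
          \<open>d y z \<le> c + (q - t)\<close> says that \<open>(y, q + c)\<close> lies below
          \<open>(z, t)\<close>. So \<open>(z, t)\<close> bounds the translate of \<open>D\<close>
          by \<open>c\<close>, hence also its supremum.\<close>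
        have "is_sup_in FB (ball_le d) (shift c D) (x, r + c)"
          using sup_standard(1)[OF D sup] real xr by simp
        moreover have "ball_le d (y, q) (z, t)" if "(y, q) \<in> shift c D" for y q
        proof -
          have "(y, q - c) \<in> D" using that by (simp add: mem_shift_iff)
          then have "t \<le> q - c" "d y z \<le> ennreal c + ennreal (q - c - t)"
            using ub real by auto
          then show ?thesis using real by (simp add: ball_le_def flip: ennreal_plus)
        qed
        ultimately have "ball_le d (x, r + c) (z, t)"
          using z t0 unfolding is_sup_in_def by (metis mem_FB surj_pair)
        then show ?thesis using real tr by (simp add: ball_le_def add.commute add_diff_eq flip: ennreal_plus)
      qed simp
      then show "ball_le d_real (d x z, r) u" using tr by (simp add: bt ball_le_def d_real_le_iff)
    qed
    then have "?h ` D \<inter> U \<noteq> {}" using U dir hs unfolding scott_open_def by blast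
    then show "D \<inter> {a \<in> FB. ?h a \<in> U} \<noteq> {}" using DFB by blast
  qed auto
qed

text \<open>Upper bound: apply the Lipschitz inequality to each \<open>h\<close> and take infima.
  Lower bound: for \<open>z\<close> in \<open>Q'\<close>, test with the distance to
  \<open>z\<close>, whose infimum over \<open>Q'\<close> is 0.\<close>

lemma d_Smyth_eq:
  assumes "Q \<subseteq> X" "Q' \<subseteq> X"
  shows "d_Smyth X d Q Q' = (SUP x'\<in>Q'. INF x\<in>Q. d x x')"
proof (rule antisym)
  let ?S = "SUP x'\<in>Q'. INF x\<in>Q. d x x'"
  show "d_Smyth X d Q Q' \<le> ?S"
    unfolding d_Smyth_def
  proof (rule SUP_least)
    fix h assume "h \<in> {h. lipschitz1_continuous X d h}"
    then have h: "h x \<le> h y + d x y" if "x \<in> X" "y \<in> X" for x y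
      using that lipschitz1_continuous_le by blast
    have "(INF x\<in>Q. h x) \<le> h x' + ?S" if x': "x' \<in> Q'" for x'
    proof (cases "Q = {}")
      case True
      have "(INF x\<in>Q. d x x') \<le> ?S" using x' by (rule SUP_upper)
      then have S: "?S = top" using True by (simp add: top_unique)
      show ?thesis unfolding S by simp
    next
      case False
      have "(INF x\<in>Q. h x) \<le> (INF x\<in>Q. h x' + d x x')"
        using h x' assms by (intro INF_mono) blast
      also have "\<dots> = h x' + (INF x\<in>Q. d x x')"
        using False by (simp add: INF_add_const_ennreal add.commute[of "h x'"])
      also have "\<dots> \<le> h x' + ?S" using x' by (intro add_left_mono SUP_upper)
      finally show ?thesis .
    qed
    then have "(INF x\<in>Q. h x) \<le> (INF x'\<in>Q'. h x' + ?S)" by (intro INF_greatest)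
    also have "\<dots> = (INF x'\<in>Q'. h x') + ?S"
      by (cases "Q' = {}") (simp_all add: INF_add_const_ennreal)
    finally show "d_real (INF x\<in>Q. h x) (INF x\<in>Q'. h x) \<le> ?S" by (simp add: d_real_le_iff)
  qed
  show "?S \<le> d_Smyth X d Q Q'"
  proof (rule SUP_least)
    fix z assume z: "z \<in> Q'"
    then have zX: "z \<in> X" using assms by blast
    have "(INF x\<in>Q'. d x z) \<le> d z z" using z by (rule INF_lower)
    then have "(INF x\<in>Q'. d x z) = 0" using qm_refl[OF zX] by simp
    then have "(INF x\<in>Q. d x z) \<le> d_real (INF x\<in>Q. d x z) (INF x\<in>Q'. d x z)"
      by (metis add_0 d_real_le_iff order_refl)
    also have "\<dots> \<le> d_Smyth X d Q Q'"
      unfolding d_Smyth_def using lipschitz1_continuous_dist[OF zX]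
      by (intro SUP_upper) simp
    finally show "(INF x\<in>Q. d x z) \<le> d_Smyth X d Q Q'" .
  qed
qed

text \<open>Compactness replaces attainment of the infimum: the open sets \<open>V e\<close> cover
  \<open>Q \<times> {0}\<close> and grow as \<open>e\<close> decreases, so the smallest
  \<open>e\<close> of a finite subcover serves all of \<open>Q\<close>.\<close>

lemma compactin_dist_gap:
  assumes Q: "compactin (d_scott X d) Q" and z: "z \<in> X" and t: "t \<ge> 0"
    and far: "\<And>x. x \<in> Q \<Longrightarrow> \<not> d x z \<le> ennreal t"
  shows "\<exists>e>0. \<forall>x\<in>Q. \<not> d x z \<le> ennreal (t + e)"
proof -
  define V where "V e = {(y, s). (y, s) \<in> FB \<and> \<not> ball_le d (y, s + (t + e)) (z, 0)}" for e
  have QX: "Q \<subseteq> X" using compactin_subset_topspace[OF Q] by (simp add: topspace_d_scott)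
  have V0: "(x, 0) \<in> V e \<longleftrightarrow> \<not> d x z \<le> ennreal (t + e)" if "x \<in> Q" "e > 0" for x e
    using that QX t by (auto simp: V_def mem_FB ball_le_def)
  have "Q \<times> {0} \<subseteq> \<Union>(V ` {0<..})"
  proof
    fix a assume "a \<in> Q \<times> {0::real}"
    then obtain x where a: "x \<in> Q" "a = (x, 0)" by blast
    have "ennreal t < d x z" using far[OF a(1)] by simp
    then obtain u where "ennreal t < u" "u < d x z" using dense by blast
    moreover obtain u' where "u = ennreal u'" "u' \<ge> 0"
      using \<open>u < d x z\<close> by (cases u) auto
    ultimately have "u' - t > 0" "\<not> d x z \<le> ennreal (t + (u' - t))"
      using t by (auto simp: ennreal_less_iff)
    then show "a \<in> \<Union>(V ` {0<..})" using V0[OF a(1)] a(2) by blast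
  qed
  moreover have "Ball (V ` {0<..}) (openin (ball_scott X d))"
    using scott_open_far[OF z] t unfolding V_def by (auto simp: openin_scott_topology)
  ultimately obtain \<F> where "finite \<F>" "\<F> \<subseteq> V ` {0<..}" "Q \<times> {0} \<subseteq> \<Union>\<F>"
    using compactin_ball[OF Q order_refl] unfolding compactin_def by meson
  then obtain E where E: "finite E" "E \<subseteq> {0<..}" "Q \<times> {0} \<subseteq> \<Union>(V ` E)"
    by (metis finite_subset_image)
  \<comment> \<open>Inserting 1 keeps the minimum defined if the subcover is empty.\<close>
  let ?e = "Min (insert 1 E)"
  have "?e > 0" using E by auto
  moreover have "\<not> d x z \<le> ennreal (t + ?e)" if x: "x \<in> Q" for x
  proof -
    obtain e where e: "e \<in> E" "(x, 0) \<in> V e" using E(3) x by blast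
    have "\<not> d x z \<le> ennreal (t + e)" using V0[OF x] e E(2) by auto
    moreover have "?e \<le> e" using E(1) e(1) by simp
    ultimately show ?thesis by (meson add_left_mono ennreal_leI order_trans)
  qed
  ultimately show ?thesis by blast
qed

lemma SmythD:
  assumes "Q \<in> Smyth X d"
  shows "Q \<noteq> {}" "compactin (d_scott X d) Q" "Q \<subseteq> X" "\<And>x y. x \<in> Q \<Longrightarrow> y \<in> X \<Longrightarrow> d x y = 0 \<Longrightarrow> y \<in> Q"
  using assms compactin_subset_topspace[of "d_scott X d" Q]
  by (auto simp: Smyth_def upward_closure_def topspace_d_scott)

lemma d_Smyth_le_iff:
  assumes Q: "Q \<in> Smyth X d" and Q': "Q' \<subseteq> X" and t: "t \<ge> 0"
  shows "d_Smyth X d Q Q' \<le> ennreal t \<longleftrightarrow> (\<forall>z\<in>Q'. \<exists>x\<in>Q. d x z \<le> ennreal t)"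
proof -
  note eq = d_Smyth_eq[OF SmythD(3)[OF Q] Q']
  show ?thesis
  proof
    assume le: "d_Smyth X d Q Q' \<le> ennreal t"
    show "\<forall>z\<in>Q'. \<exists>x\<in>Q. d x z \<le> ennreal t"
    proof (rule ballI, rule ccontr)
      fix z assume z: "z \<in> Q'" and "\<not> (\<exists>x\<in>Q. d x z \<le> ennreal t)"
      then obtain e where e: "e > 0" "\<And>x. x \<in> Q \<Longrightarrow> \<not> d x z \<le> ennreal (t + e)"
        using compactin_dist_gap[OF SmythD(2)[OF Q] _ t] Q' by blast
      have "ennreal (t + e) \<le> (INF x\<in>Q. d x z)"
        using e(2) by (intro INF_greatest) (meson linear)
      also have "\<dots> \<le> d_Smyth X d Q Q'" unfolding eq using z by (rule SUP_upper)
      also note le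
      finally show False using e(1) t by simp
    qed
  next
    assume "\<forall>z\<in>Q'. \<exists>x\<in>Q. d x z \<le> ennreal t"
    then show "d_Smyth X d Q Q' \<le> ennreal t"
      unfolding eq by (intro SUP_least) (meson INF_lower order_trans)
  qed
qed

text \<open>Balls over the powerdomain are thus compared by the Smyth preorder on the sets
  \<open>Q \<times> {r}\<close>; later arguments use this form instead of suprema over Lipschitz
  maps.\<close>

lemma ball_le_Smyth_iff:
  assumes "Q \<in> Smyth X d" "Q' \<subseteq> X"
  shows "ball_le (d_Smyth X d) (Q, r) (Q', s) \<longleftrightarrow>
    s \<le> r \<and> (\<forall>z\<in>Q'. \<exists>x\<in>Q. ball_le d (x, r) (z, s))"
  using d_Smyth_le_iff[OF assms, of "r - s"] by (auto simp: ball_le_def)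

text \<open>Distance 0 is reverse inclusion because the sets are saturated, which gives separation.
  The triangle inequality passes from \<open>d_real\<close> through the supremum over
  \<open>h\<close>.\<close>

lemma quasi_metric_on_Smyth: "quasi_metric_on (Smyth X d) (d_Smyth X d)"
  unfolding quasi_metric_on_def
proof (intro conjI ballI impI)
  have le0: "d_Smyth X d Q Q' = 0 \<longleftrightarrow> Q' \<subseteq> Q" if "Q \<in> Smyth X d" "Q' \<in> Smyth X d" for Q Q'
  proof -
    have "d_Smyth X d Q Q' = 0 \<longleftrightarrow> (\<forall>z\<in>Q'. \<exists>x\<in>Q. d x z = 0)"
      using d_Smyth_le_iff[OF that(1) SmythD(3)[OF that(2)], of 0] by simp
    also have "\<dots> \<longleftrightarrow> Q' \<subseteq> Q"
      using SmythD(3)[OF that(2)] SmythD(4)[OF that(1)] qm_refl by blast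
    finally show ?thesis .
  qed
  show "d_Smyth X d Q Q = 0" if "Q \<in> Smyth X d" for Q using le0 that by blast
  show "Q = Q'" if "Q \<in> Smyth X d" "Q' \<in> Smyth X d" "d_Smyth X d Q Q' = 0 \<and> d_Smyth X d Q' Q = 0"
    for Q Q' using le0 that by blast
  fix P Q R
  have "d_real a c \<le> d_real a b + d_real b c" for a b c
    using quasi_metric_on_d_real by (simp add: quasi_metric_on_def)
  then show "d_Smyth X d P R \<le> d_Smyth X d P Q + d_Smyth X d Q R"
    unfolding d_Smyth_def
    by (intro SUP_least order_trans[OF _ add_mono[OF SUP_upper SUP_upper]]) auto
qed

section \<open>Finitely generated saturated sets\<close>

text \<open>Open sets are upward closed, so one member of a cover per generator suffices. Points
  above a generator are never closer to \<open>z\<close> than the generator, so distances can be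
  tested on \<open>F\<close>.\<close>

lemma upward_closure_finite:
  assumes F: "finite F" "F \<noteq> {}" "F \<subseteq> X"
  shows "upward_closure X d F \<in> Smyth X d"
    and "\<And>Q t. Q \<subseteq> X \<Longrightarrow> t \<ge> 0 \<Longrightarrow>
      d_Smyth X d (upward_closure X d F) Q \<le> ennreal t \<longleftrightarrow> (\<forall>z\<in>Q. \<exists>x\<in>F. d x z \<le> ennreal t)"
proof -
  let ?Q = "upward_closure X d F"
  have sub: "?Q \<subseteq> X" "F \<subseteq> ?Q" using F qm_refl by (auto simp: upward_closure_def)
  have "compactin (d_scott X d) ?Q"
    unfolding compactin_def topspace_d_scott
  proof (intro conjI allI impI sub(1))
    fix \<U> assume \<U>: "Ball \<U> (openin (d_scott X d)) \<and> ?Q \<subseteq> \<Union>\<U>"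
    then have "\<forall>x\<in>F. \<exists>U\<in>\<U>. x \<in> U" using sub(2) by blast
    then obtain U where U: "\<And>x. x \<in> F \<Longrightarrow> U x \<in> \<U> \<and> x \<in> U x" by metis
    have "?Q \<subseteq> \<Union>(U ` F)"
    proof
      fix y assume "y \<in> ?Q"
      then obtain x where x: "x \<in> F" "d x y = 0" "y \<in> X" by (auto simp: upward_closure_def)
      then have "y \<in> U x"
        using specialization_d_scott[OF qm, of x y] U[of x] \<U> F by blast
      then show "y \<in> \<Union>(U ` F)" using x by blast
    qed
    then show "\<exists>\<F>. finite \<F> \<and> \<F> \<subseteq> \<U> \<and> ?Q \<subseteq> \<Union>\<F>"
      using F(1) U by (intro exI[of _ "U ` F"]) auto
  qed
  moreover have "upward_closure X d ?Q = ?Q"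
  proof
    show "?Q \<subseteq> upward_closure X d ?Q" using sub qm_refl by (auto simp: upward_closure_def)
    show "upward_closure X d ?Q \<subseteq> ?Q"
    proof
      fix z assume "z \<in> upward_closure X d ?Q"
      then obtain x y where xyz: "x \<in> F" "d x y = 0" "d y z = 0" "y \<in> X" "z \<in> X"
        by (auto simp: upward_closure_def)
      then have "d x z = 0" using qm_triangle[of x y z] F by auto
      then show "z \<in> ?Q" using xyz by (auto simp: upward_closure_def)
    qed
  qed
  ultimately show S: "?Q \<in> Smyth X d" using F sub by (auto simp: Smyth_def)
  fix Q and t :: real assume Q: "Q \<subseteq> X" and t: "t \<ge> 0"
  show "d_Smyth X d ?Q Q \<le> ennreal t \<longleftrightarrow> (\<forall>z\<in>Q. \<exists>x\<in>F. d x z \<le> ennreal t)"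
    unfolding d_Smyth_le_iff[OF S Q t]
  proof (intro ball_cong refl iffI)
    fix z assume z: "z \<in> Q" and "\<exists>y\<in>?Q. d y z \<le> ennreal t"
    then obtain x y where xy: "x \<in> F" "d x y = 0" "y \<in> X" "d y z \<le> ennreal t"
      by (auto simp: upward_closure_def)
    then have "d x z \<le> ennreal t" using qm_triangle[of x y z] subsetD[OF F(3)] subsetD[OF Q z] by auto
    then show "\<exists>x\<in>F. d x z \<le> ennreal t" using xy by blast
  qed (use sub in blast)
qed

end

subsection \<open>Center points and bases\<close>

text \<open>For \<open>x\<close> a center point, \<open>open_ball X d x \<epsilon>\<close> is the set of formal balls way above \<open>(x, \<epsilon>)\<close>.\<close>

definition open_ball :: "'a set \<Rightarrow> ('a \<Rightarrow> 'a \<Rightarrow> ennreal) \<Rightarrow> 'a \<Rightarrow> real \<Rightarrow> ('a \<times> real) set" where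
  "open_ball X d x \<epsilon> = {(y, s). (y, s) \<in> formal_balls X \<and> d x y < ennreal (\<epsilon> - s)}"

lemma less_ennreal_obtain:
  assumes "a < ennreal r"
  obtains p where "0 \<le> p" "p < r" "a = ennreal p"
  using assms by (cases a) (auto simp: ennreal_less_iff)

lemma open_ball_upward:
  assumes qm: "quasi_metric_on X d" and x: "x \<in> X"
    and a: "a \<in> open_ball X d x \<epsilon>" and b: "b \<in> formal_balls X" "ball_le d a b"
  shows "b \<in> open_ball X d x \<epsilon>"
proof -
  obtain y s z t where ab: "a = (y, s)" "b = (z, t)" by fastforce
  obtain p where p: "0 \<le> p" "p < \<epsilon> - s" "d x y = ennreal p"
    using a less_ennreal_obtain by (auto simp: open_ball_def ab)
  have st: "t \<le> s" "d y z \<le> ennreal (s - t)" using b by (auto simp: ab ball_le_def)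
  have "d x z \<le> d x y + d y z"
    using qm x a b by (auto simp: quasi_metric_on_def open_ball_def formal_balls_def ab)
  also have "\<dots> \<le> ennreal p + ennreal (s - t)" using p st by (intro add_mono) auto
  also have "\<dots> = ennreal (p + (s - t))" using p st by simp
  also have "\<dots> < ennreal (\<epsilon> - t)" using p st by (subst ennreal_less_iff) auto
  finally show ?thesis using b by (simp add: open_ball_def ab)
qed

text \<open>The restriction to positive \<open>\<epsilon>\<close> disappears because the other open
  balls are empty.\<close>

lemma center_points_iff:
  "x \<in> center_points X d \<longleftrightarrow>
    x \<in> X \<and> (\<forall>\<epsilon>. scott_open (formal_balls X) (ball_le d) (open_ball X d x \<epsilon>))"
proof -
  have "open_ball X d x \<epsilon> = {}" if "\<epsilon> \<le> 0" for \<epsilon>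
    using that by (auto simp: open_ball_def formal_balls_def ennreal_neg)
  moreover have "scott_open (formal_balls X) (ball_le d) {}" by (simp add: scott_open_def)
  ultimately have "(\<forall>\<epsilon>>0. scott_open (formal_balls X) (ball_le d) (open_ball X d x \<epsilon>)) \<longleftrightarrow>
      (\<forall>\<epsilon>. scott_open (formal_balls X) (ball_le d) (open_ball X d x \<epsilon>))"
    by (metis linorder_not_le)
  then show ?thesis
    unfolding center_points_def openin_scott_topology open_ball_def by simp
qed

lemma scott_open_Un: "scott_open P le U \<Longrightarrow> scott_open P le V \<Longrightarrow> scott_open P le (U \<union> V)"
  using openin_Un[of "scott_topology P le"] by (simp add: openin_scott_topology)

lemma scott_open_Int: "scott_open P le U \<Longrightarrow> scott_open P le V \<Longrightarrow> scott_open P le (U \<inter> V)"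
  using openin_Int[of "scott_topology P le"] by (simp add: openin_scott_topology)

lemma scott_open_Union: "(\<And>U. U \<in> K \<Longrightarrow> scott_open P le U) \<Longrightarrow> scott_open P le (\<Union>K)"
  using openin_Union[of K "scott_topology P le"] by (simp add: openin_scott_topology)

lemma scott_open_carrier: "scott_open P le P"
  using openin_topspace[of "scott_topology P le"]
  by (simp add: openin_scott_topology topspace_scott_topology)

text \<open>The ball \<open>(x, r)\<close> is the directed supremum of the \<open>(x, t)\<close>
  with \<open>t\<close> decreasing to \<open>r\<close>. This supplies the slack that turns weak
  inequalities into strict ones.\<close>

lemma scott_open_enlarge:
  assumes qm: "quasi_metric_on X d" and V: "scott_open (formal_balls X) (ball_le d) V"
    and xr: "(x, r) \<in> V" and e: "e > 0"
  obtains t where "r < t" "t < r + e" "(x, t) \<in> V"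
proof -
  let ?D = "Pair x ` {r<..<r + e}"
  have FB: "x \<in> X" "0 \<le> r" using V xr by (auto simp: scott_open_def formal_balls_def)
  then have x0: "d x x = 0" using qm by (simp add: quasi_metric_on_def)
  have "directed_in (formal_balls X) (ball_le d) ?D"
    unfolding directed_in_def
  proof (intro conjI ballI)
    show "?D \<subseteq> formal_balls X" using FB by (auto simp: formal_balls_def)
    show "?D \<noteq> {}" using e by simp
    fix a b assume "a \<in> ?D" "b \<in> ?D"
    then obtain s t where "a = (x, s)" "b = (x, t)" "s \<in> {r<..<r + e}" "t \<in> {r<..<r + e}" by blast
    then show "\<exists>c\<in>?D. ball_le d a c \<and> ball_le d b c"
      using x0 by (intro bexI[of _ "(x, min s t)"]) (auto simp: ball_le_def min_def)
  qed
  moreover have "is_sup_in (formal_balls X) (ball_le d) ?D (x, r)"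
    unfolding is_sup_in_def
  proof (intro conjI ballI impI)
    show "(x, r) \<in> formal_balls X" using FB by (simp add: formal_balls_def)
    show "ball_le d a (x, r)" if "a \<in> ?D" for a using that x0 by (auto simp: ball_le_def)
    fix u assume u: "u \<in> formal_balls X" "\<forall>a\<in>?D. ball_le d a u"
    obtain z s where zs: "u = (z, s)" by fastforce
    have le: "s \<le> t" "d x z \<le> ennreal (t - s)" if "r < t" "t < r + e" for t
      using u(2) that by (auto simp: zs ball_le_def)
    have sr: "s \<le> r"
    proof (rule field_le_epsilon)
      fix \<delta> :: real assume "\<delta> > 0"
      then have "s \<le> r + min (e / 2) \<delta>" using le(1)[of "r + min (e / 2) \<delta>"] e by linarith
      then show "s \<le> r + \<delta>" by linarith
    qed
    have "d x z \<le> ennreal (r - s)"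
    proof (rule ennreal_le_epsilon)
      fix \<delta> :: real assume d: "\<delta> > 0"
      have "d x z \<le> ennreal (r + min (e / 2) \<delta> - s)"
        using le(2)[of "r + min (e / 2) \<delta>"] e d by linarith
      also have "\<dots> \<le> ennreal ((r - s) + \<delta>)" by (intro ennreal_leI) linarith
      also have "\<dots> = ennreal (r - s) + ennreal \<delta>" using sr d by simp
      finally show "d x z \<le> ennreal (r - s) + ennreal \<delta>" .
    qed
    then show "ball_le d (x, r) u" using sr by (simp add: zs ball_le_def)
  qed
  ultimately have "?D \<inter> V \<noteq> {}" using V xr unfolding scott_open_def by blast
  then show thesis using that by auto
qed

section \<open>Approximation from a strong basis\<close>

locale algebraic_yoneda_qm = yoneda_qm +
  fixes B
  assumes basis: "strong_basis X d B"
begin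

lemma basis_mem:
  assumes "b \<in> B"
  shows "b \<in> X \<and> scott_open FB (ball_le d) (open_ball X d b \<epsilon>)"
proof -
  have "b \<in> center_points X d" using assms basis by (auto simp: strong_basis_def)
  then show ?thesis unfolding center_points_iff by blast
qed

text \<open>Continuity of the dcpo of formal balls: every ball in an open \<open>V\<close> has a
  basic ball way below it, still in \<open>V\<close> and of nearly the same radius. It comes from
  the family approximating \<open>(x, 0)\<close>, translated by \<open>r\<close>.\<close>

lemma basis_approx:
  assumes V: "scott_open FB (ball_le d) V" and xr: "(x, r) \<in> V" and e: "e > 0"
  shows "\<exists>b\<in>B. \<exists>t. (b, t) \<in> V \<and> (x, r) \<in> open_ball X d b t \<and> t < r + e"
proof -
  have FB: "x \<in> X" "0 \<le> r" using V xr by (auto simp: scott_open_def mem_FB)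
  then obtain D0 where D0: "directed_in FB (ball_le d) D0" "fst ` D0 \<subseteq> B"
      "is_sup_in FB (ball_le d) D0 (x, 0)"
    using basis unfolding strong_basis_def by blast
  let ?D = "shift r D0"
  have D: "directed_in FB (ball_le d) ?D"
    using D0(1) FB by (intro directed_in_shift) (auto simp: directed_in_def formal_balls_def)
  have sup: "is_sup_in FB (ball_le d) ?D (x, r)"
    using sup_standard(1)[OF D0(1,3), of r] FB by simp
  obtain b1 where b1: "b1 \<in> ?D" "b1 \<in> V" using V D sup xr unfolding scott_open_def by blast
  obtain b2 t2 where b2: "(b2, t2) \<in> ?D" "t2 < r + e" using sup_standard(2)[OF D sup e] by blast
  obtain b t where b: "(b, t) \<in> ?D" "ball_le d b1 (b, t)" "ball_le d (b2, t2) (b, t)"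
    using D b1 b2 unfolding directed_in_def by (metis surj_pair)
  have bV: "(b, t) \<in> V" using V b1 b D unfolding scott_open_def directed_in_def by blast
  have t: "t < r + e" using b(3) b2(2) by (simp add: ball_le_def)
  \<comment> \<open>A basic ball below \<open>(x, r)\<close> only gives
    \<open>d b x \<le> t - r\<close>; enlarging \<open>t\<close> within \<open>V\<close> makes this
    strict.\<close>
  obtain t' where t': "t < t'" "t' < t + (r + e - t)" "(b, t') \<in> V"
    using scott_open_enlarge[OF qm V bV, of "r + e - t"] t by auto
  have "r \<le> t" "d b x \<le> ennreal (t - r)" using sup b(1) by (auto simp: is_sup_in_def ball_le_def)
  moreover from this have "ennreal (t - r) < ennreal (t' - r)"
    using t' by (subst ennreal_less_iff) auto
  ultimately have "d b x < ennreal (t' - r)" by (meson order_le_less_trans)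
  moreover have "b \<in> B" using b(1) D0(2) by (force simp: mem_shift_iff)
  ultimately show ?thesis using t' FB by (auto simp: open_ball_def mem_FB intro!: bexI[of _ b] exI[of _ t'])
qed

lemma ball_le_by_basis:
  assumes xr: "(x, r) \<in> FB" and w: "w \<in> FB"
    and le: "\<And>b t. b \<in> B \<Longrightarrow> (b, t) \<in> FB \<Longrightarrow> (x, r) \<in> open_ball X d b t \<Longrightarrow> ball_le d (b, t) w"
  shows "ball_le d (x, r) w"
proof (rule ccontr)
  assume "\<not> ball_le d (x, r) w"
  then have "(x, r) \<in> {b \<in> FB. \<not> ball_le d b w}" using xr by simp
  then obtain b t where "b \<in> B" "(b, t) \<in> {b \<in> FB. \<not> ball_le d b w}" "(x, r) \<in> open_ball X d b t"
    using basis_approx[OF scott_open_not_below[OF qm w] _ zero_less_one] by blast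
  then show False using le by blast
qed

lemma open_ball_imp_ball_le: "(y, s) \<in> open_ball X d b t \<Longrightarrow> ball_le d (b, t) (y, s)"
  by (cases "s \<le> t") (auto simp: open_ball_def ball_le_def ennreal_neg)

subsection \<open>Well-filteredness of the space of formal balls\<close>

abbreviation "SX \<equiv> Smyth X d"
abbreviation "dS \<equiv> d_Smyth X d"

text \<open>Zorn's lemma applies because each \<open>Q \<times> {r}\<close> is compact: if the union
  of a chain contained it, so would a single member. The complement of \<open>M\<close> is a minimal
  closed set meeting every \<open>Q \<times> {r}\<close> and avoiding \<open>V\<close>.\<close>

lemma maximal_open:
  assumes D: "D \<subseteq> formal_balls SX" "D \<noteq> {}" and V: "scott_open FB (ball_le d) V"
    and not: "\<And>Q r. (Q, r) \<in> D \<Longrightarrow> \<not> Q \<times> {r} \<subseteq> V"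
  obtains M where "scott_open FB (ball_le d) M" "V \<subseteq> M" "\<And>Q r. (Q, r) \<in> D \<Longrightarrow> \<not> Q \<times> {r} \<subseteq> M"
    "\<And>U. scott_open FB (ball_le d) U \<Longrightarrow> \<not> U \<subseteq> M \<Longrightarrow> \<exists>(Q, r)\<in>D. Q \<times> {r} \<subseteq> M \<union> U"
proof -
  define \<A> where "\<A> = {U. scott_open FB (ball_le d) U \<and> V \<subseteq> U \<and> (\<forall>(Q, r)\<in>D. \<not> Q \<times> {r} \<subseteq> U)}"
  have "\<exists>M\<in>\<A>. \<forall>U\<in>\<A>. M \<subseteq> U \<longrightarrow> U = M"
  proof (rule subset_Zorn_nonempty)
    show "\<A> \<noteq> {}" using V not unfolding \<A>_def by blast
    fix \<C> assume \<C>: "\<C> \<noteq> {}" "subset.chain \<A> \<C>"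
    then have sub: "\<C> \<subseteq> \<A>" by (simp add: subset_chain_def)
    have "\<not> Q \<times> {r} \<subseteq> \<Union>\<C>" if Qr: "(Q, r) \<in> D" for Q r
    proof
      assume cov: "Q \<times> {r} \<subseteq> \<Union>\<C>"
      have "compactin (ball_scott X d) (Q \<times> {r})"
        using Qr D SmythD(2) by (intro compactin_ball) (auto simp: formal_balls_def)
      moreover have "Ball \<C> (openin (ball_scott X d))"
        using sub by (auto simp: \<A>_def openin_scott_topology)
      ultimately obtain \<F> where \<F>: "finite \<F>" "\<F> \<subseteq> \<C>" "Q \<times> {r} \<subseteq> \<Union>\<F>"
        using cov unfolding compactin_def by meson
      obtain U where "U \<in> \<C>" "\<Union>\<F> \<subseteq> U"
      proof (cases "\<F> = {}")
        case False
        have "subset.chain \<A> \<F>" using \<C>(2) \<F>(2) unfolding subset_chain_def by (meson order_trans subsetD)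
        then have "\<Union>\<F> \<in> \<F>" using Union_in_chain[OF \<F>(1) False] by blast
        then show ?thesis using that[of "\<Union>\<F>"] \<F>(2) by blast
      qed (use \<C> that in blast)
      then have "U \<in> \<A>" "Q \<times> {r} \<subseteq> U" using sub \<F>(3) by auto
      then show False using Qr by (auto simp: \<A>_def)
    qed
    then show "\<Union>\<C> \<in> \<A>"
      using \<C>(1) sub scott_open_Union[of \<C> FB "ball_le d"] unfolding \<A>_def by blast
  qed
  then obtain M where M: "M \<in> \<A>" and max: "\<And>U. U \<in> \<A> \<Longrightarrow> M \<subseteq> U \<Longrightarrow> U = M" by blast
  show thesis
  proof (rule that[of M])
    fix U assume U: "scott_open FB (ball_le d) U" "\<not> U \<subseteq> M"
    then have "M \<union> U \<notin> \<A>" using max[of "M \<union> U"] by blast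
    then show "\<exists>(Q, r)\<in>D. Q \<times> {r} \<subseteq> M \<union> U"
      using M U(1) scott_open_Un[of FB "ball_le d" M U] unfolding \<A>_def by blast
  qed (use M in \<open>auto simp: \<A>_def\<close>)
qed

text \<open>This lets a common upper bound in a directed family inherit the open covers of both
  members below it.\<close>

lemma Smyth_ball_subset_mono:
  assumes V: "scott_open FB (ball_le d) V" and Qr: "(Q, r) \<in> formal_balls SX" "Q \<times> {r} \<subseteq> V"
    and Ps: "(P, s) \<in> formal_balls SX" "ball_le dS (Q, r) (P, s)"
  shows "P \<times> {s} \<subseteq> V"
proof
  fix a assume "a \<in> P \<times> {s}"
  then obtain z where z: "a = (z, s)" "z \<in> P" by blast
  have mem: "Q \<in> SX" "P \<in> SX" "0 \<le> s" using Qr Ps by (auto simp: formal_balls_def)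
  then obtain y where "y \<in> Q" "ball_le d (y, r) (z, s)"
    using ball_le_Smyth_iff[OF mem(1) SmythD(3)[OF mem(2)]] Ps(2) z by blast
  moreover have "(z, s) \<in> FB" using SmythD(3)[OF mem(2)] z(2) mem(3) by (auto simp: mem_FB)
  ultimately show "a \<in> V" using V Qr(2) z unfolding scott_open_def by blast
qed

text \<open>The classical route through sobriety, by contradiction. \<open>lim\<close> says that
  \<open>V\<close> contains the radius-0 part of the intersection of the upward closures. The
  generic point of the complement of a maximal open \<open>M\<close> lies in that intersection,
  hence in \<open>V\<close> and in \<open>M\<close>, which is absurd.\<close>

lemma Smyth_well_filtered:
  assumes D: "directed_in (formal_balls SX) (ball_le dS) D"
    and small: "\<And>e. e > 0 \<Longrightarrow> \<exists>(Q, r)\<in>D. r < e"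
    and V: "scott_open FB (ball_le d) V"
    and lim: "\<And>x. x \<in> X \<Longrightarrow> (\<And>Q r. (Q, r) \<in> D \<Longrightarrow> \<exists>y\<in>Q. ball_le d (y, r) (x, 0)) \<Longrightarrow> (x, 0) \<in> V"
  shows "\<exists>(Q, r)\<in>D. Q \<times> {r} \<subseteq> V"
proof (rule ccontr)
  assume neg: "\<not> (\<exists>(Q, r)\<in>D. Q \<times> {r} \<subseteq> V)"
  have DS: "D \<subseteq> formal_balls SX" "D \<noteq> {}" using D by (auto simp: directed_in_def)
  obtain M where M: "scott_open FB (ball_le d) M" "V \<subseteq> M"
    and out: "\<And>Q r. (Q, r) \<in> D \<Longrightarrow> \<not> Q \<times> {r} \<subseteq> M"
    and max: "\<And>U. scott_open FB (ball_le d) U \<Longrightarrow> \<not> U \<subseteq> M \<Longrightarrow> \<exists>(Q, r)\<in>D. Q \<times> {r} \<subseteq> M \<union> U"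
    using maximal_open[OF DS V] neg by blast
  have out': "\<exists>y\<in>Q. (y, r) \<in> FB - M" if Qr: "(Q, r) \<in> D" for Q r
    using out[OF Qr] Qr DS(1) SmythD(3)[of Q] by (force simp: formal_balls_def)
  text \<open>The complement of \<open>M\<close> is an irreducible closed set; \<open>E\<close> is the trace of the basis on it,
    and the supremum of \<open>E\<close> is its generic point.\<close>
  define E where "E = {(b, t). b \<in> B \<and> (b, t) \<in> FB \<and> open_ball X d b t - M \<noteq> {}}"
  have EM: "(b, t) \<notin> M" if bt: "(b, t) \<in> E" for b t
  proof
    assume "(b, t) \<in> M"
    obtain y s where ys: "(y, s) \<in> open_ball X d b t" "(y, s) \<notin> M"
      using bt unfolding E_def by fastforce
    then have "ball_le d (b, t) (y, s)" "(y, s) \<in> FB"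
      using open_ball_imp_ball_le by (auto simp: open_ball_def)
    then show False using M(1) \<open>(b, t) \<in> M\<close> ys unfolding scott_open_def by blast
  qed
  have dirE: "directed_in FB (ball_le d) E"
    unfolding directed_in_def
  proof (intro conjI ballI)
    show "E \<subseteq> FB" by (auto simp: E_def)
    obtain Q r where "(Q, r) \<in> D" using DS(2) by auto
    then obtain y where y: "(y, r) \<in> FB - M" using out' by blast
    obtain b t where "b \<in> B" "(b, t) \<in> FB" "(y, r) \<in> open_ball X d b t"
      using basis_approx[OF scott_open_carrier, of y r 1] y by auto
    then show "E \<noteq> {}" using y unfolding E_def by blast
    fix a1 a2 assume a: "a1 \<in> E" "a2 \<in> E"
    obtain b1 t1 b2 t2 where b: "a1 = (b1, t1)" "a2 = (b2, t2)" by fastforce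
    let ?U1 = "open_ball X d b1 t1" and ?U2 = "open_ball X d b2 t2"
    have U: "scott_open FB (ball_le d) ?U1" "scott_open FB (ball_le d) ?U2"
      using a basis_mem by (auto simp: b E_def)
    \<comment> \<open>Maximality makes \<open>M\<close> with either ball cover a member of
      \<open>D\<close>, so \<open>M\<close> with each of them covers a common upper bound
      \<open>P \<times> {s}\<close>. A point of the latter outside \<open>M\<close> lies in both
      balls, and the basis interpolates there.\<close>
    obtain Q1 r1 Q2 r2 where Q: "(Q1, r1) \<in> D" "Q1 \<times> {r1} \<subseteq> M \<union> ?U1"
        "(Q2, r2) \<in> D" "Q2 \<times> {r2} \<subseteq> M \<union> ?U2"
      using max[OF U(1)] max[OF U(2)] a unfolding b E_def by blast
    obtain P s where P: "(P, s) \<in> D" "ball_le dS (Q1, r1) (P, s)" "ball_le dS (Q2, r2) (P, s)"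
      using D Q(1,3) unfolding directed_in_def by (metis surj_pair)
    have "P \<times> {s} \<subseteq> M \<union> ?U1"
      using Smyth_ball_subset_mono[OF scott_open_Un[OF M(1) U(1)] _ Q(2) _ P(2)] Q P DS(1)
      by blast
    moreover have "P \<times> {s} \<subseteq> M \<union> ?U2"
      using Smyth_ball_subset_mono[OF scott_open_Un[OF M(1) U(2)] _ Q(4) _ P(3)] Q P DS(1)
      by blast
    moreover obtain y where y: "y \<in> P" "(y, s) \<in> FB - M" using out'[OF P(1)] by blast
    ultimately have yU: "(y, s) \<in> ?U1 \<inter> ?U2" by blast
    then obtain c u where c: "c \<in> B" "(c, u) \<in> ?U1 \<inter> ?U2" "(y, s) \<in> open_ball X d c u"
      using basis_approx[OF scott_open_Int[OF U] yU zero_less_one] by blast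
    then have "(c, u) \<in> E" using y unfolding E_def open_ball_def by blast
    then show "\<exists>c\<in>E. ball_le d a1 c \<and> ball_le d a2 c"
      using open_ball_imp_ball_le c(2) unfolding b by blast
  qed
  obtain x u where sup: "is_sup_in FB (ball_le d) E (x, u)"
    using yoneda dirE unfolding yoneda_complete_def dcpo_on_def by (metis surj_pair)
  have xu: "(x, u) \<in> FB" using sup by (simp add: is_sup_in_def)
  have notM: "(x, u) \<notin> M"
  proof
    assume "(x, u) \<in> M"
    then have "E \<inter> M \<noteq> {}" using M(1) dirE sup unfolding scott_open_def by blast
    then show False using EM by auto
  qed
  have below: "ball_le d (y, r) (x, u)" if y: "(y, r) \<in> FB - M" for y r
  proof (rule ball_le_by_basis)
    fix b t assume "b \<in> B" "(b, t) \<in> FB" "(y, r) \<in> open_ball X d b t"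
    then have "(b, t) \<in> E" using y unfolding E_def by blast
    then show "ball_le d (b, t) (x, u)" using sup by (auto simp: is_sup_in_def)
  qed (use y xu in auto)
  \<comment> \<open>Each member of \<open>D\<close> has a ball outside \<open>M\<close>, hence below
    \<open>(x, u)\<close>, so \<open>u\<close> is at most every radius in \<open>D\<close>.\<close>
  have "u \<le> 0"
  proof (rule field_le_epsilon)
    fix e :: real assume "e > 0"
    then obtain Q r where "(Q, r) \<in> D" "r < e" using small by blast
    moreover from this obtain y where "ball_le d (y, r) (x, u)" using out' below by blast
    ultimately show "u \<le> 0 + e" by (simp add: ball_le_def)
  qed
  then have u: "u = 0" using xu by (simp add: mem_FB)
  have "(x, 0) \<in> V"
  proof (rule lim)
    show "x \<in> X" using xu by (simp add: mem_FB)
    show "\<exists>y\<in>Q. ball_le d (y, r) (x, 0)" if "(Q, r) \<in> D" for Q r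
      using out'[OF that] below u by blast
  qed
  then show False using notM M(2) u by blast
qed

subsection \<open>The Smyth powerdomain\<close>

text \<open>After translation to infimum radius 0, \<open>Q\<close> is the radius-0 part of the
  intersection of the upward closures. The last conclusion retains well-filteredness for use with
  center points.\<close>

lemma Smyth_directed_sup:
  assumes D: "directed_in (formal_balls SX) (ball_le dS) D"
  obtains Q m where "0 \<le> m" "Q \<in> SX" "is_sup_in (formal_balls SX) (ball_le dS) D (Q, m)"
    "\<And>V. scott_open FB (ball_le d) V \<Longrightarrow> Q \<times> {0} \<subseteq> V \<Longrightarrow> \<exists>(P, r)\<in>D. P \<times> {r - m} \<subseteq> V"
proof -
  obtain m where m: "0 \<le> m" "\<And>P r. (P, r) \<in> D \<Longrightarrow> m \<le> r"
      "\<And>e. e > 0 \<Longrightarrow> \<exists>(P, r)\<in>D. r < m + e"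
    using directed_radius_Inf[OF D] by metis
  define D' where "D' = shift (- m) D"
  have D'_iff: "(P, r) \<in> D' \<longleftrightarrow> (P, r + m) \<in> D" for P r by (simp add: D'_def mem_shift_iff)
  have dir: "directed_in (formal_balls SX) (ball_le dS) D'"
    unfolding D'_def using m(2) by (intro directed_in_shift[OF D]) force
  have mem: "P \<in> SX" "0 \<le> r" if "(P, r) \<in> D'" for P r
    using dir that by (auto simp: directed_in_def formal_balls_def)
  have small: "\<exists>(P, r)\<in>D'. r < e" if "e > 0" for e
    using m(3)[OF that] by (force simp: D'_def shift_def)
  define Q where "Q = {x \<in> X. \<forall>(P, r)\<in>D'. \<exists>y\<in>P. ball_le d (y, r) (x, 0)}"
  have QI: "x \<in> Q" if "x \<in> X" "\<And>P r. (P, r) \<in> D' \<Longrightarrow> \<exists>y\<in>P. ball_le d (y, r) (x, 0)" for x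
    using that by (auto simp: Q_def)
  have QD: "\<exists>y\<in>P. ball_le d (y, r) (x, 0)" if "x \<in> Q" "(P, r) \<in> D'" for x P r
    using that by (auto simp: Q_def)
  have QX: "Q \<subseteq> X" by (auto simp: Q_def)
  have wf: "\<exists>(P, r)\<in>D'. P \<times> {r} \<subseteq> V"
    if "scott_open FB (ball_le d) V" "\<And>x. x \<in> Q \<Longrightarrow> (x, 0) \<in> V" for V
    using that Smyth_well_filtered[OF dir small, of V] QI by blast
  have "Q \<noteq> {}"
  \<comment> \<open>Well-filteredness for the empty open set would give an empty member of the
    family.\<close>
  proof
    assume "Q = {}"
    then obtain P r where "(P, r) \<in> D'" "P \<times> {r} \<subseteq> {}"
      using wf[of "{}"] by (auto simp: scott_open_def)
    then show False using mem SmythD(1) by blast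
  qed
  moreover have "compactin (d_scott X d) Q"
  proof (rule compactin_ball_0, unfold compactin_def topspace_scott_topology, intro conjI allI impI)
    show "Q \<times> {0} \<subseteq> FB" using QX by (auto simp: mem_FB)
    fix \<U> assume \<U>: "Ball \<U> (openin (ball_scott X d)) \<and> Q \<times> {0} \<subseteq> \<Union>\<U>"
    then have op: "scott_open FB (ball_le d) U" if "U \<in> \<U>" for U
      using that by (simp add: openin_scott_topology)
    have "scott_open FB (ball_le d) (\<Union>\<U>)" using op by (rule scott_open_Union)
    then obtain P r where P: "(P, r) \<in> D'" "P \<times> {r} \<subseteq> \<Union>\<U>"
      using wf[of "\<Union>\<U>"] \<U> by blast
    have "compactin (ball_scott X d) (P \<times> {r})"
      using compactin_ball SmythD(2) mem P(1) by blast
    then obtain \<F> where \<F>: "finite \<F>" "\<F> \<subseteq> \<U>" "P \<times> {r} \<subseteq> \<Union>\<F>"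
      using P(2) \<U> unfolding compactin_def by meson
    have "(x, 0) \<in> \<Union>\<F>" if x: "x \<in> Q" for x
    proof -
      obtain y where y: "y \<in> P" "ball_le d (y, r) (x, 0)" using QD[OF x P(1)] by blast
      then obtain U where U: "U \<in> \<F>" "(y, r) \<in> U" using \<F>(3) by blast
      moreover have "(x, 0) \<in> FB" using x QX by (auto simp: mem_FB)
      ultimately have "(x, 0) \<in> U" using y op[of U] \<F>(2) unfolding scott_open_def by blast
      then show ?thesis using U by blast
    qed
    then show "\<exists>\<F>. finite \<F> \<and> \<F> \<subseteq> \<U> \<and> Q \<times> {0} \<subseteq> \<Union>\<F>" using \<F> by blast
  qed
  moreover have "upward_closure X d Q = Q"
  proof
    show "Q \<subseteq> upward_closure X d Q" using QX qm_refl by (auto simp: upward_closure_def)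
    show "upward_closure X d Q \<subseteq> Q"
    proof
      fix z assume "z \<in> upward_closure X d Q"
      then obtain x where x: "x \<in> Q" "d x z = 0" "z \<in> X" by (auto simp: upward_closure_def)
      show "z \<in> Q"
      proof (rule QI[OF x(3)])
        fix P r assume P: "(P, r) \<in> D'"
        obtain y where y: "y \<in> P" "ball_le d (y, r) (x, 0)" using QD[OF x(1) P] by blast
        moreover have "ball_le d (x, 0) (z, 0)" using x by (simp add: ball_le_def)
        ultimately have "ball_le d (y, r) (z, 0)"
          using ball_le_trans[OF qm, of "(y, r)" "(x, 0)" "(z, 0)"] SmythD(3) mem[OF P] x QX
          by (auto simp: mem_FB)
        then show "\<exists>y\<in>P. ball_le d (y, r) (z, 0)" using y by blast
      qed
    qed
  qed
  ultimately have QS: "Q \<in> SX" by (simp add: Smyth_def)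
  have "is_sup_in (formal_balls SX) (ball_le dS) D (Q, m)"
    unfolding is_sup_in_def
  proof (intro conjI ballI impI)
    show "(Q, m) \<in> formal_balls SX" using QS m by (simp add: formal_balls_def)
    fix a assume a: "a \<in> D"
    obtain P r where Pr: "a = (P, r)" by fastforce
    then have P: "(P, r - m) \<in> D'" using a by (simp add: D'_iff)
    then have "ball_le dS (P, r - m) (Q, 0)"
      using ball_le_Smyth_iff[OF mem(1)[OF P] QX] QD[OF _ P] mem(2)[OF P] by blast
    then show "ball_le dS a (Q, m)"
      using ball_le_shift[of dS P "r - m" m Q 0] Pr by simp
  next
    fix u assume u: "u \<in> formal_balls SX" "\<forall>a\<in>D. ball_le dS a u"
    obtain R s where Rs: "u = (R, s)" by fastforce
    have R: "R \<in> SX" "0 \<le> s" using u Rs by (auto simp: formal_balls_def)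
    have ub: "ball_le dS (P, r + m) (R, s)" if "(P, r) \<in> D'" for P r
      using u that by (auto simp: Rs D'_iff)
    have sm: "s \<le> m"
    proof (rule field_le_epsilon)
      fix e :: real assume "e > 0"
      then show "s \<le> m + e" using m(3) u(2) by (fastforce simp: Rs ball_le_def)
    qed
    have "\<exists>x\<in>Q. ball_le d (x, m) (z, s)" if z: "z \<in> R" for z
    proof (rule ccontr)
      assume not: "\<not> (\<exists>x\<in>Q. ball_le d (x, m) (z, s))"
      have zX: "z \<in> X" using z SmythD(3)[OF R(1)] by blast
      \<comment> \<open>If \<open>Q\<close> does not reach \<open>z\<close>, this open set contains
        \<open>Q \<times> {0}\<close>, hence some \<open>P \<times> {r}\<close>, against
        \<open>(P, r + m)\<close> being below \<open>(R, s)\<close>.\<close>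
      let ?V = "{(y, t). (y, t) \<in> FB \<and> \<not> ball_le d (y, t + (m - s)) (z, 0)}"
      have sh: "ball_le d (y, t + (m - s)) (z, 0) \<longleftrightarrow> ball_le d (y, t + m) (z, s)" for y t
        using ball_le_shift[of d y "t + (m - s)" s z 0] by simp
      have op: "scott_open FB (ball_le d) ?V" using scott_open_far[OF zX, of "m - s"] sm by simp
      have inV: "(x, 0) \<in> ?V" if "x \<in> Q" for x
        using that not QX sh[of x 0] by (auto simp: mem_FB)
      obtain P r where P: "(P, r) \<in> D'" "P \<times> {r} \<subseteq> ?V"
        using wf[OF op inV] by blast
      then obtain y where "y \<in> P" "ball_le d (y, r + m) (z, s)"
        using ub[OF P(1)] ball_le_Smyth_iff[OF mem(1)[OF P(1)] SmythD(3)[OF R(1)]] z by blast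
      then show False using P(2) sh by auto
    qed
    then show "ball_le dS (Q, m) u"
      using ball_le_Smyth_iff[OF QS SmythD(3)[OF R(1)]] sm by (simp add: Rs)
  qed
  moreover have "\<exists>(P, r)\<in>D. P \<times> {r - m} \<subseteq> V"
    if V: "scott_open FB (ball_le d) V" "Q \<times> {0} \<subseteq> V" for V
  proof -
    obtain P r where "(P, r) \<in> D'" "P \<times> {r} \<subseteq> V" using wf[OF V(1)] V(2) by blast
    then show ?thesis by (intro bexI[of _ "(P, r + m)"]) (auto simp: D'_iff)
  qed
  ultimately show thesis using that m(1) QS by blast
qed

lemma yoneda_complete_Smyth: "yoneda_complete SX dS"
  unfolding yoneda_complete_def dcpo_on_def using Smyth_directed_sup by metis

text \<open>The open balls around the generators have a Scott-open union; if it contains the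
  supremum's set at radius 0, well-filteredness puts a member of the directed family inside
  it.\<close>

lemma center_points_Smyth:
  assumes F: "finite F" "F \<noteq> {}" "F \<subseteq> center_points X d"
  shows "upward_closure X d F \<in> center_points SX dS"
  unfolding center_points_iff
proof (intro conjI allI)
  let ?F = "upward_closure X d F"
  have FX: "F \<subseteq> X" using F(3) by (auto simp: center_points_def)
  note FS = upward_closure_finite[OF F(1,2) FX]
  show "?F \<in> SX" by (rule FS)
  fix \<epsilon>
  show "scott_open (formal_balls SX) (ball_le dS) (open_ball SX dS ?F \<epsilon>)"
    unfolding scott_open_def
  proof (intro conjI ballI allI impI)
    show "open_ball SX dS ?F \<epsilon> \<subseteq> formal_balls SX" by (auto simp: open_ball_def)
    show "b \<in> open_ball SX dS ?F \<epsilon>"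
      if "a \<in> open_ball SX dS ?F \<epsilon>" "b \<in> formal_balls SX" "ball_le dS a b" for a b
      using open_ball_upward[OF quasi_metric_on_Smyth FS(1)] that by blast
    fix D s assume Ds: "directed_in (formal_balls SX) (ball_le dS) D
      \<and> is_sup_in (formal_balls SX) (ball_le dS) D s \<and> s \<in> open_ball SX dS ?F \<epsilon>"
    then have D: "directed_in (formal_balls SX) (ball_le dS) D"
      "is_sup_in (formal_balls SX) (ball_le dS) D s" "s \<in> open_ball SX dS ?F \<epsilon>" by auto
    obtain Q m where Q: "0 \<le> m" "Q \<in> SX" "is_sup_in (formal_balls SX) (ball_le dS) D (Q, m)"
      and wf: "\<And>V. scott_open FB (ball_le d) V \<Longrightarrow> Q \<times> {0} \<subseteq> V \<Longrightarrow> \<exists>(P, r)\<in>D. P \<times> {r - m} \<subseteq> V"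
      by (rule Smyth_directed_sup[OF D(1)]) blast
    have "s = (Q, m)" by (rule is_sup_in_unique[OF quasi_metric_on_Smyth D(2) Q(3)])
    then have "dS ?F Q < ennreal (\<epsilon> - m)" using D(3) by (simp add: open_ball_def)
    then obtain p where p: "0 \<le> p" "p < \<epsilon> - m" "dS ?F Q = ennreal p"
      by (rule less_ennreal_obtain)
    \<comment> \<open>The intermediate \<open>q\<close> gives strictness twice: \<open>p < q\<close>
      puts \<open>Q \<times> {0}\<close> inside the open balls, and
      \<open>q < \<epsilon> - m\<close> makes the final bound strict.\<close>
    then obtain q where q: "p < q" "q < \<epsilon> - m" using dense by blast
    let ?V = "\<Union>x\<in>F. open_ball X d x q"
    have "scott_open FB (ball_le d) ?V"
      using F(3) by (intro scott_open_Union) (auto simp: center_points_iff)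
    moreover have "Q \<times> {0} \<subseteq> ?V"
    proof
      fix a assume "a \<in> Q \<times> {0::real}"
      then obtain y where y: "a = (y, 0)" "y \<in> Q" by blast
      then obtain x where x: "x \<in> F" "d x y \<le> ennreal p"
        using FS(2)[OF SmythD(3)[OF Q(2)] p(1)] p(3) by auto
      have "ennreal p < ennreal q" using q(1) p(1) by (simp add: ennreal_less_iff)
      then have "d x y < ennreal q" using x(2) by (meson order_le_less_trans)
      then show "a \<in> ?V" using x y SmythD(3)[OF Q(2)] by (auto simp: open_ball_def mem_FB)
    qed
    ultimately obtain P r where P: "(P, r) \<in> D" "P \<times> {r - m} \<subseteq> ?V" using wf by blast
    have PS: "(P, r) \<in> formal_balls SX" "P \<in> SX" using P(1) D(1) by (auto simp: directed_in_def formal_balls_def)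
    have near: "\<exists>x\<in>F. d x y < ennreal (q - (r - m))" if "y \<in> P" for y
      using P(2) that by (force simp: open_ball_def)
    \<comment> \<open>Since \<open>ennreal\<close> truncates at 0, positivity of
      \<open>q - (r - m)\<close> must be extracted from an actual point of \<open>P\<close>.\<close>
    obtain y where "y \<in> P" using SmythD(1)[OF PS(2)] by blast
    with near obtain x where "d x y < ennreal (q - (r - m))" by blast
    then obtain p' where "0 \<le> p'" "p' < q - (r - m)" by (rule less_ennreal_obtain)
    then have pos: "q - (r - m) > 0" by linarith
    have "dS ?F P \<le> ennreal (q - (r - m))"
      using FS(2)[OF SmythD(3)[OF PS(2)]] near pos by (meson less_imp_le)
    also have "\<dots> < ennreal (\<epsilon> - r)" using q pos by (simp add: ennreal_less_iff)
    finally show "D \<inter> open_ball SX dS ?F \<epsilon> \<noteq> {}" using P(1) PS(1) by (auto simp: open_ball_def)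
  qed
qed

section \<open>Approximation by finitely generated sets\<close>

text \<open>Compactness extracts finitely many small basic balls covering
  \<open>Q \<times> {0}\<close>. The largest of their radii is still below \<open>e\<close>, and
  their centers inherit membership in \<open>W\<close>.\<close>

lemma finite_approx:
  assumes Q: "Q \<in> SX" and W: "scott_open FB (ball_le d) W" "Q \<times> {0} \<subseteq> W" and e: "e > 0"
  obtains F where "finite F" "F \<noteq> {}" "F \<subseteq> B" "dS (upward_closure X d F) Q < ennreal e"
    "\<And>b. b \<in> F \<Longrightarrow> \<exists>t. (b, t) \<in> W \<and> t < e"
proof -
  define I where "I = {(b, t). b \<in> B \<and> (b, t) \<in> W \<and> t < e}"
  define U where "U = (\<lambda>(b, t). open_ball X d b t)"
  have "Q \<times> {0} \<subseteq> \<Union>(U ` I)"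
  proof
    fix a assume a: "a \<in> Q \<times> {0::real}"
    then obtain x where x: "a = (x, 0)" "x \<in> Q" by blast
    then have "(x, 0) \<in> W" using W(2) by blast
    then obtain b t where "b \<in> B" "(b, t) \<in> W" "(x, 0) \<in> open_ball X d b t" "t < 0 + e"
      using basis_approx[OF W(1) _ e, of x 0] by blast
    then show "a \<in> \<Union>(U ` I)" using x by (force simp: I_def U_def)
  qed
  moreover have "Ball (U ` I) (openin (ball_scott X d))"
    using basis_mem by (auto simp: I_def U_def openin_scott_topology)
  ultimately obtain \<F> where "finite \<F>" "\<F> \<subseteq> U ` I" "Q \<times> {0} \<subseteq> \<Union>\<F>"
    using compactin_ball[OF SmythD(2)[OF Q] order_refl] unfolding compactin_def by meson
  then obtain J where J: "finite J" "J \<subseteq> I" "Q \<times> {0} \<subseteq> \<Union>(U ` J)"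
    by (metis finite_subset_image)
  let ?F = "fst ` J" and ?M = "Max (snd ` J)"
  have ne: "J \<noteq> {}" using J(3) SmythD(1)[OF Q] by auto
  have FX: "?F \<subseteq> B" "?F \<subseteq> X" using J(2) basis_mem by (auto simp: I_def)
  have t: "0 \<le> t" "t < e" if "(b, t) \<in> J" for b t
    using that J(2) W(1) by (auto simp: I_def scott_open_def mem_FB)
  have M: "?M \<in> snd ` J" using J(1) ne by (intro Max_in) auto
  then have M': "0 \<le> ?M" "?M < e" using t by (metis imageE surjective_pairing)+
  have "\<exists>b\<in>?F. d b x \<le> ennreal ?M" if x: "x \<in> Q" for x
  proof -
    obtain b s where b: "(b, s) \<in> J" "(x, 0) \<in> open_ball X d b s"
      using J(3) x by (force simp: U_def)
    have "s \<le> ?M" using b(1) J(1) by (intro Max_ge) force+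
    then have "d b x \<le> ennreal ?M"
      using b(2) by (auto simp: open_ball_def intro: order_trans[OF less_imp_le ennreal_leI])
    then show ?thesis using b(1) by force
  qed
  then have "dS (upward_closure X d ?F) Q \<le> ennreal ?M"
    using upward_closure_finite(2)[of ?F Q ?M] J(1) ne FX(2) SmythD(3)[OF Q] M' by auto
  also have "\<dots> < ennreal e" using M' by (simp add: ennreal_less_iff)
  finally have "dS (upward_closure X d ?F) Q < ennreal e" .
  moreover have "\<exists>t. (b, t) \<in> W \<and> t < e" if "b \<in> ?F" for b
    using that J(2) by (auto simp: I_def)
  ultimately show thesis using that[of ?F] J(1) ne FX by blast
qed

text \<open>The approximating family consists of the finitely generated balls at distance strictly
  less than their radius from \<open>Q\<close>; the strict bound leaves room for
  directedness.\<close>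

lemma strong_basis_Smyth:
  "strong_basis SX dS {upward_closure X d F | F. finite F \<and> F \<noteq> {} \<and> F \<subseteq> B}"
  unfolding strong_basis_def
proof (intro conjI ballI)
  have BC: "B \<subseteq> center_points X d" using basis by (simp add: strong_basis_def)
  then show "{upward_closure X d F | F. finite F \<and> F \<noteq> {} \<and> F \<subseteq> B} \<subseteq> center_points SX dS"
    using center_points_Smyth by blast
  have BX: "B \<subseteq> X" using basis_mem by blast
  fix Q assume Q: "Q \<in> SX"
  note QX = SmythD(3)[OF Q]
  define D where "D = {(upward_closure X d F, r) | F r. finite F \<and> F \<noteq> {} \<and> F \<subseteq> B
    \<and> 0 < r \<and> dS (upward_closure X d F) Q < ennreal r}"
  have DI: "(upward_closure X d F, r) \<in> D"
    if "finite F" "F \<noteq> {}" "F \<subseteq> B" "0 < r" "dS (upward_closure X d F) Q < ennreal r" for F r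
    using that by (auto simp: D_def)
  have DE: "\<exists>F p. finite F \<and> F \<noteq> {} \<and> F \<subseteq> B \<and> F \<subseteq> X \<and> P = upward_closure X d F \<and> 0 \<le> p \<and> p < r
      \<and> (\<forall>z\<in>Q. \<exists>b\<in>F. d b z \<le> ennreal p)" if "(P, r) \<in> D" for P r
  proof -
    obtain F where F: "finite F" "F \<noteq> {}" "F \<subseteq> B" "P = upward_closure X d F" "dS P Q < ennreal r"
      using \<open>(P, r) \<in> D\<close> by (auto simp: D_def)
    then obtain p where p: "0 \<le> p" "p < r" "dS P Q = ennreal p" using less_ennreal_obtain by blast
    then show ?thesis
      using F upward_closure_finite(2)[of F Q p] BX QX by (intro exI[of _ F] exI[of _ p]) auto
  qed
  have FB0: "Q \<times> {0} \<subseteq> FB" using QX by (auto simp: mem_FB)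
  have small: "\<exists>P. (P, r) \<in> D" if "r > 0" for r
    using finite_approx[OF Q scott_open_carrier FB0 that] DI that by metis
  have "directed_in (formal_balls SX) (ball_le dS) D"
    unfolding directed_in_def
  proof (intro conjI ballI)
    show "D \<subseteq> formal_balls SX"
      using upward_closure_finite(1) BX by (fastforce simp: D_def formal_balls_def)
    show "D \<noteq> {}" using small[of 1] by auto
    fix a1 a2 assume a: "a1 \<in> D" "a2 \<in> D"
    obtain P1 r1 P2 r2 where a12: "a1 = (P1, r1)" "a2 = (P2, r2)" by fastforce
    obtain F1 p1 where F1: "finite F1" "F1 \<noteq> {}" "F1 \<subseteq> B" "F1 \<subseteq> X" "P1 = upward_closure X d F1"
        "0 \<le> p1" "p1 < r1" "\<And>z. z \<in> Q \<Longrightarrow> \<exists>b\<in>F1. d b z \<le> ennreal p1"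
      using DE a a12 by metis
    obtain F2 p2 where F2: "finite F2" "F2 \<noteq> {}" "F2 \<subseteq> B" "F2 \<subseteq> X" "P2 = upward_closure X d F2"
        "0 \<le> p2" "p2 < r2" "\<And>z. z \<in> Q \<Longrightarrow> \<exists>b\<in>F2. d b z \<le> ennreal p2"
      using DE a a12 by metis
    \<comment> \<open>Half of the smaller gap is spent on opening the balls to radius
      \<open>p + e\<close>, the other half on the radius \<open>e\<close> of the new
      element.\<close>
    define e where "e = min (r1 - p1) (r2 - p2) / 2"
    have e: "e > 0" "p1 + e \<le> r1 - e" "p2 + e \<le> r2 - e"
      using F1(7) F2(7) by (auto simp: e_def min_def field_simps)
    define W1 where "W1 = (\<Union>b\<in>F1. open_ball X d b (p1 + e))"
    define W2 where "W2 = (\<Union>b\<in>F2. open_ball X d b (p2 + e))"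
    have op: "scott_open FB (ball_le d) W1" "scott_open FB (ball_le d) W2"
      unfolding W1_def W2_def using F1(3) F2(3) basis_mem by (auto intro!: scott_open_Union)
    have in_W: "(z, 0) \<in> (\<Union>b\<in>F. open_ball X d b (p + e))"
      if "z \<in> Q" "0 \<le> p" and near: "\<exists>b\<in>F. d b z \<le> ennreal p" for F p z
    proof -
      obtain b where b: "b \<in> F" "d b z \<le> ennreal p" using near by blast
      have "ennreal p < ennreal (p + e)" using that e(1) by (simp add: ennreal_less_iff)
      then have "d b z < ennreal (p + e)" using b(2) by simp
      then show ?thesis using b(1) that(1) QX by (auto simp: open_ball_def mem_FB)
    qed
    have "Q \<times> {0} \<subseteq> W1 \<inter> W2"
      using in_W[OF _ F1(6) F1(8)] in_W[OF _ F2(6) F2(8)] unfolding W1_def W2_def by blast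
    then obtain F where F: "finite F" "F \<noteq> {}" "F \<subseteq> B" "dS (upward_closure X d F) Q < ennreal e"
      and FW: "\<And>b. b \<in> F \<Longrightarrow> \<exists>t. (b, t) \<in> W1 \<inter> W2 \<and> t < e"
      using finite_approx[OF Q scott_open_Int[OF op] _ e(1)] by blast
    have FX: "F \<subseteq> X" using F(3) BX by blast
    have le: "ball_le dS (upward_closure X d G, r) (upward_closure X d F, e)"
      if G: "finite G" "G \<noteq> {}" "G \<subseteq> X" "0 \<le> p" "p + e \<le> r - e"
        and W: "\<And>b. b \<in> F \<Longrightarrow> \<exists>t. (b, t) \<in> (\<Union>c\<in>G. open_ball X d c (p + e))" for G p r
    proof -
      have "\<exists>c\<in>G. d c z \<le> ennreal (r - e)" if z: "z \<in> upward_closure X d F" for z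
      proof -
        obtain b where b: "b \<in> F" "d b z = 0" "z \<in> X" using z by (auto simp: upward_closure_def)
        obtain c t where c: "c \<in> G" "(b, t) \<in> open_ball X d c (p + e)" using W[OF b(1)] by blast
        have "d c z \<le> d c b + d b z" using qm_triangle c b FX G(3) by (meson subsetD)
        also have "\<dots> \<le> ennreal (p + e - t)" using c(2) b(2) by (auto simp: open_ball_def)
        also have "\<dots> \<le> ennreal (r - e)" using c(2) G(5) by (intro ennreal_leI) (auto simp: open_ball_def mem_FB)
        finally show ?thesis using c(1) by blast
      qed
      moreover have "upward_closure X d F \<subseteq> X" by (auto simp: upward_closure_def)
      ultimately have "dS (upward_closure X d G) (upward_closure X d F) \<le> ennreal (r - e)"
        using upward_closure_finite(2)[OF G(1-3), of "upward_closure X d F" "r - e"] G e(1) by auto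
      then show ?thesis using G e(1) by (simp add: ball_le_def)
    qed
    have "ball_le dS a1 (upward_closure X d F, e)"
      unfolding a12 F1(5) using FW e(2) unfolding W1_def
      by (intro le[OF F1(1,2,4,6)]) blast+
    moreover have "ball_le dS a2 (upward_closure X d F, e)"
      unfolding a12 F2(5) using FW e(3) unfolding W2_def
      by (intro le[OF F2(1,2,4,6)]) blast+
    ultimately show "\<exists>c\<in>D. ball_le dS a1 c \<and> ball_le dS a2 c" using DI[OF F(1-3) e(1) F(4)] by blast
  qed
  moreover have "fst ` D \<subseteq> {upward_closure X d F | F. finite F \<and> F \<noteq> {} \<and> F \<subseteq> B}"
    by (auto simp: D_def)
  moreover have "is_sup_in (formal_balls SX) (ball_le dS) D (Q, 0)"
    unfolding is_sup_in_def
  proof (intro conjI ballI impI)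
    show "(Q, 0) \<in> formal_balls SX" using Q by (simp add: formal_balls_def)
    show "ball_le dS a (Q, 0)" if "a \<in> D" for a using that by (auto simp: D_def ball_le_def)
    fix u assume u: "u \<in> formal_balls SX" "\<forall>a\<in>D. ball_le dS a u"
    obtain R s where Rs: "u = (R, s)" by fastforce
    have R: "R \<in> SX" "0 \<le> s" using u Rs by (auto simp: formal_balls_def)
    note RX = SmythD(3)[OF R(1)]
    have "s \<le> 0"
    proof (rule field_le_epsilon)
      fix e :: real assume "e > 0"
      then show "s \<le> 0 + e" using small u(2) by (fastforce simp: Rs ball_le_def)
    qed
    then have s: "s = 0" using R by simp
    have "\<exists>x\<in>Q. d x z \<le> ennreal 0" if z: "z \<in> R" for z
    proof (rule ccontr)
      assume "\<not> (\<exists>x\<in>Q. d x z \<le> ennreal 0)"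
      then obtain c where c: "c > 0" "\<And>x. x \<in> Q \<Longrightarrow> \<not> d x z \<le> ennreal (0 + c)"
        using compactin_dist_gap[OF SmythD(2)[OF Q], of z 0] RX z by blast
      \<comment> \<open>Centers of balls in this set are more than \<open>c\<close> away from
        \<open>z\<close>, whereas \<open>u\<close> being an upper bound forces some generator within
        \<open>c\<close> of \<open>z\<close>.\<close>
      let ?V = "{(y, t). (y, t) \<in> FB \<and> \<not> ball_le d (y, t + c) (z, 0)}"
      have "Q \<times> {0} \<subseteq> ?V" using c QX by (auto simp: mem_FB ball_le_def)
      moreover have "scott_open FB (ball_le d) ?V"
        using scott_open_far[of z c] RX z c(1) by auto
      ultimately obtain F where F: "finite F" "F \<noteq> {}" "F \<subseteq> B"
          "dS (upward_closure X d F) Q < ennreal c"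
        and FV: "\<And>b. b \<in> F \<Longrightarrow> \<exists>t. (b, t) \<in> ?V \<and> t < c"
        using finite_approx[OF Q _ _ c(1)] by blast
      have "ball_le dS (upward_closure X d F, c) (R, 0)" using DI[OF F(1-3) c(1) F(4)] u s Rs by blast
      then have "dS (upward_closure X d F) R \<le> ennreal c" by (simp add: ball_le_def)
      then obtain b where b: "b \<in> F" "d b z \<le> ennreal c"
        using upward_closure_finite(2)[OF F(1,2) order_trans[OF F(3) BX] RX, of c] c(1) z by auto
      obtain t where "0 \<le> t" "\<not> ball_le d (b, t + c) (z, 0)" using FV[OF b(1)] by (auto simp: mem_FB)
      moreover from this have "d b z \<le> ennreal (t + c)" using b(2) by (meson ennreal_leI le_add_same_cancel2 order_trans)
      ultimately show False using c(1) by (simp add: ball_le_def)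
    qed
    then have "dS Q R \<le> ennreal 0" using d_Smyth_le_iff[OF Q RX, of 0] by simp
    then show "ball_le dS (Q, 0) u" by (simp add: Rs s ball_le_def)
  qed
  ultimately show "\<exists>D. directed_in (formal_balls SX) (ball_le dS) D
      \<and> fst ` D \<subseteq> {upward_closure X d F | F. finite F \<and> F \<noteq> {} \<and> F \<subseteq> B}
      \<and> is_sup_in (formal_balls SX) (ball_le dS) D (Q, 0)" by blast
qed

end

theorem theorem13p20:
  fixes X :: "'a set" and d :: "'a \<Rightarrow> 'a \<Rightarrow> ennreal" and B :: "'a set"
  assumes "quasi_metric_on X d" and "yoneda_complete X d" and "algebraic_qm X d"
    and "strong_basis X d B"
  shows "quasi_metric_on (Smyth X d) (d_Smyth X d)
       \<and> yoneda_complete (Smyth X d) (d_Smyth X d)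
       \<and> algebraic_qm (Smyth X d) (d_Smyth X d)
       \<and> (\<forall>F. finite F \<and> F \<noteq> {} \<and> F \<subseteq> center_points X d \<longrightarrow>
              upward_closure X d F \<in> center_points (Smyth X d) (d_Smyth X d))
       \<and> strong_basis (Smyth X d) (d_Smyth X d)
            {upward_closure X d F | F. finite F \<and> F \<noteq> {} \<and> F \<subseteq> center_points X d}
       \<and> strong_basis (Smyth X d) (d_Smyth X d)
            {upward_closure X d F | F. finite F \<and> F \<noteq> {} \<and> F \<subseteq> B}"
proof -
  interpret algebraic_yoneda_qm X d B by unfold_locales (fact assms)+
  \<comment> \<open>The center points contain \<open>B\<close> and so form a strong basis too; a
    second interpretation of the locale covers that case.\<close>
  have "strong_basis X d (center_points X d)"
    using assms(4) unfolding strong_basis_def by (meson order_refl order_trans)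
  then interpret C: algebraic_yoneda_qm X d "center_points X d" by unfold_locales
  show ?thesis
    using quasi_metric_on_Smyth yoneda_complete_Smyth strong_basis_Smyth C.strong_basis_Smyth
      center_points_Smyth
    unfolding algebraic_qm_def by blast
qed

end
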